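(* Let $q$ be a prime power and $a,b,d,u$ positive integers. Then: (1) If $2u<d$ or $\min\{a,b\}<d$, then $\Lambda(q,a,b,d,u)=1$. (2) If $\min\{a,b\}\le u$, then $\Lambda(q,a,b,d,u)=M(q,a,b,d)$. (3) $\Lambda(q,a,b,1,u)=\sum_{r=0}^{\min\{u,a,b\}}q^{\binom r2}(q-1)^r[r]_q!\binom{a}{r}_q\binom{b}{r}_q$. (4) $\Lambda(q,a,b,2u,u)=A_q(\min\{a,b\},2u;u)$.
   Context: $\Lambda(q,a,b,d,u)$ is the maximum size of a set of $a\times b$ matrices over $\mathbb{F}_q$ such that any two distinct elements $X,Y$ satisfy $\mathrm{rk}(X-Y)\ge d$ and every element has rank at most $u$. $M(q,a,b,d)=\lceil q^{\max\{a,b\}(\min\{a,b\}-d+1)}\rceil$. $A_q(v,d;k)$ is the maximum number of $k$-dimensional subspaces of $\mathbb{F}_q^v$ with pairwise subspace distance $\dim(U+W)-\dim(U\cap W)$ at least $d$. $[n]_q=(q^n-1)/(q-1)$, $[r]_q!=\prod_{i=1}^r[i]_q$, $\binom{n}{k}_q=\prod_{i=0}^{k-1}\frac{q^n-q^i}{q^k-q^i}$.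
   Formalization: Item (4) is stated only for u ≤ min{a,b}; for u > min{a,b} it fails, since Λ(q,a,b,2u,u)=1 by item (1) while F_q^{min{a,b}} has no u-dimensional subspaces, so A_q(min{a,b},2u;u)=0 (e.g. a=b=1, u=2). *)

theory Defs
  imports
    "Jordan_Normal_Form.DL_Rank"
    "HOL-Library.Cardinality"
    "HOL-Number_Theory.Prime_Powers"
begin

text \<open>
  The finite field with \<open>q\<close> elements is represented by a type \<open>'f :: {finite, field}\<close> with
  \<open>CARD('f) = q\<close>; the quantities depending on the field take \<open>TYPE('f)\<close> as an argument.
\<close>

definition mat_rank :: "'f::field mat \<Rightarrow> nat" where
  "mat_rank X = vec_space.rank (dim_row X) X"

definition rank_metric_code ::
  "nat \<Rightarrow> nat \<Rightarrow> nat \<Rightarrow> nat \<Rightarrow> 'f::field mat set \<Rightarrow> bool" where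
  "rank_metric_code a b d u C \<longleftrightarrow>
     C \<subseteq> carrier_mat a b \<and>
     (\<forall>X\<in>C. \<forall>Y\<in>C. X \<noteq> Y \<longrightarrow> d \<le> mat_rank (X - Y)) \<and>
     (\<forall>X\<in>C. mat_rank X \<le> u)"

definition Lambda :: "'f::{finite,field} itself \<Rightarrow> nat \<Rightarrow> nat \<Rightarrow> nat \<Rightarrow> nat \<Rightarrow> nat" where
  "Lambda F a b d u = Max (card ` {C :: 'f mat set. rank_metric_code a b d u C})"

text \<open>
  The exponent is an integer: it is negative for \<open>d > min a b + 1\<close>, and then the
  ceiling yields \<open>1\<close>.
\<close>

definition M_bound :: "nat \<Rightarrow> nat \<Rightarrow> nat \<Rightarrow> nat \<Rightarrow> int" where
  "M_bound q a b d = \<lceil>real q powi (int (max a b) * (int (min a b) - int d + 1))\<rceil>"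

definition subspace_dim :: "nat \<Rightarrow> 'f::field vec set \<Rightarrow> nat" where
  "subspace_dim v U = vectorspace.dim class_ring ((module_vec TYPE('f) v)\<lparr>carrier := U\<rparr>)"

definition subspace_dist :: "nat \<Rightarrow> 'f::field vec set \<Rightarrow> 'f vec set \<Rightarrow> nat" where
  "subspace_dist v U W =
     subspace_dim v (module.submodule_sum (module_vec TYPE('f) v) U W) - subspace_dim v (U \<inter> W)"

definition constant_dim_code ::
  "nat \<Rightarrow> nat \<Rightarrow> nat \<Rightarrow> 'f::field vec set set \<Rightarrow> bool" where
  "constant_dim_code v d k C \<longleftrightarrow>
     (\<forall>U\<in>C. VectorSpace.subspace class_ring U (module_vec TYPE('f) v) \<and> subspace_dim v U = k) \<and>
     (\<forall>U\<in>C. \<forall>W\<in>C. U \<noteq> W \<longrightarrow> d \<le> subspace_dist v U W)"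

text \<open>For \<open>k > v\<close> only the empty code exists, so \<open>A_code F v d k = 0\<close>.\<close>

definition A_code :: "'f::{finite,field} itself \<Rightarrow> nat \<Rightarrow> nat \<Rightarrow> nat \<Rightarrow> nat" where
  "A_code F v d k = Max (card ` {C :: 'f vec set set. constant_dim_code v d k C})"

definition q_int :: "nat \<Rightarrow> nat \<Rightarrow> real" where
  "q_int q n = (real q ^ n - 1) / (real q - 1)"

definition q_fact :: "nat \<Rightarrow> nat \<Rightarrow> real" where
  "q_fact q r = (\<Prod>i=1..r. q_int q i)"

definition q_binomial :: "nat \<Rightarrow> nat \<Rightarrow> nat \<Rightarrow> real" where
  "q_binomial q n k = (\<Prod>i<k. (real q ^ n - real q ^ i) / (real q ^ k - real q ^ i))"

text \<open>Both maxima range over finite nonempty sets.\<close>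

lemma finite_carrier_vec_finite: "finite (carrier_vec n :: 'f::finite vec set)"
proof (rule finite_subset)
  show "carrier_vec n \<subseteq> vec_of_list ` {xs :: 'f list. set xs \<subseteq> UNIV \<and> length xs = n}"
  proof
    fix x :: "'f vec" assume "x \<in> carrier_vec n"
    then have "x = vec_of_list (list_of_vec x)" "length (list_of_vec x) = n"
      by (auto simp: vec_list)
    then show "x \<in> vec_of_list ` {xs. set xs \<subseteq> UNIV \<and> length xs = n}" by blast
  qed
qed (intro finite_imageI finite_lists_length_eq finite)

lemma finite_carrier_mat_finite: "finite (carrier_mat a b :: 'f::finite mat set)"
proof (rule finite_subset)
  show "carrier_mat a b \<subseteq>
    mat_of_rows b ` {rs :: 'f vec list. set rs \<subseteq> carrier_vec b \<and> length rs = a}"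
  proof
    fix X :: "'f mat" assume X: "X \<in> carrier_mat a b"
    then have "X = mat_of_rows b (rows X)"
      using mat_of_rows_rows[of X] by auto
    moreover from X have "set (rows X) \<subseteq> carrier_vec b" "length (rows X) = a"
      by (auto simp: rows_def)
    ultimately show "X \<in> mat_of_rows b ` {rs. set rs \<subseteq> carrier_vec b \<and> length rs = a}" by blast
  qed
qed (intro finite_imageI finite_lists_length_eq finite_carrier_vec_finite)

lemma Lambda_Max_wf:
  "finite {C :: 'f::{finite,field} mat set. rank_metric_code a b d u C}"
  "{C :: 'f mat set. rank_metric_code a b d u C} \<noteq> {}"
proof -
  have "{C :: 'f mat set. rank_metric_code a b d u C} \<subseteq> Pow (carrier_mat a b)"
    by (auto simp: rank_metric_code_def)
  then show "finite {C :: 'f mat set. rank_metric_code a b d u C}"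
    by (rule finite_subset) (simp add: finite_carrier_mat_finite)
  have "rank_metric_code a b d u ({} :: 'f mat set)" by (simp add: rank_metric_code_def)
  then show "{C :: 'f mat set. rank_metric_code a b d u C} \<noteq> {}" by blast
qed

lemma A_code_Max_wf:
  "finite {C :: 'f::{finite,field} vec set set. constant_dim_code v d k C}"
  "{C :: 'f vec set set. constant_dim_code v d k C} \<noteq> {}"
proof -
  have "U \<subseteq> carrier_vec v" if "VectorSpace.subspace class_ring U (module_vec TYPE('f) v)" for U
    using that by (auto simp: VectorSpace.subspace_def submodule_def module_vec_def)
  then have "{C :: 'f vec set set. constant_dim_code v d k C} \<subseteq> Pow (Pow (carrier_vec v))"
    by (auto simp: constant_dim_code_def)
  then show "finite {C :: 'f vec set set. constant_dim_code v d k C}"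
    by (rule finite_subset) (simp add: finite_carrier_vec_finite)
  have "constant_dim_code v d k ({} :: 'f vec set set)" by (simp add: constant_dim_code_def)
  then show "{C :: 'f vec set set. constant_dim_code v d k C} \<noteq> {}" by blast
qed

end

theory Submission
  imports
    Defs
    "Jordan_Normal_Form.Matrix_Kernel"
    "HOL-Algebra.Algebraic_Closure_Type"
    "HOL-Number_Theory.Residues"
begin

text \<open>
  Over a finite field with \<open>q\<close> elements dimensions are read off from cardinalities: the image of a
  matrix of rank \<open>r\<close> has \<open>q ^ r\<close> elements, and with \<open>b\<close> columns its kernel has \<open>q ^ (b - r)\<close>.

  For (2), deleting \<open>d - 1\<close> columns is injective on a code, which gives the upper bound; it is
  attained by Gabidulin's codes of linearized polynomials over an extension field. For (3), the code
  of all matrices of rank at most \<open>u\<close> is optimal, and matrices of given rank are counted by appending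
  columns one at a time, which matches the \<open>q\<close>-Pascal recursion. For (4), in a code of size at least
  2 all matrices have rank exactly \<open>u\<close> and their column spaces intersect trivially in pairs; conversely,
  if \<open>B\<close> is a basis matrix of a member of a code of subspaces and \<open>E\<close> pads with zero rows, the matrices
  \<open>B (E B)\<^sup>T\<close> have column and row spaces that intersect trivially in pairs, so that the ranks add up.
\<close>

text \<open>Counting works because for \<open>q > 1\<close> a power of \<open>q\<close> determines
  its exponent, so rank inequalities become inclusions and injections between finite sets. The
  extension field has a variable degree and hence no type of its own; it is cut out of the algebraic
  closure as the set of roots of x^(q^n) - x. A Gabidulin matrix of size \<open>a\<close> by
  \<open>b\<close> needs \<open>b\<close> independent elements in an extension of degree
  \<open>a\<close>, hence \<open>b \<le> a\<close>; transposition supplies the other order. In (4)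
  everything rests on writing \<open>P * S\<^sup>T - R * T\<^sup>T\<close> as the product of the
  block matrix [P | R] with the transpose of [S | -T]. The ranks are sure to add up once both blocks
  have independent columns, so trivially intersecting column spaces alone are not enough: the second
  factors must be independent as well. Reusing the basis matrix as its own second factor achieves
  this, and padding it to the larger side is why the smaller side is put first.\<close>

no_notation fps_nth (infixl \<open>$\<close> 75)
no_notation Polynomials.var (\<open>X\<index>\<close>)
hide_const (open) Divisibility.prime up_ring.monom up_ring.coeff Polynomials.degree Polynomials.lead_coeff

section \<open>Rank and cardinality over a finite field\<close>

lemma card_carrier_vec: "card (carrier_vec n :: 'f::finite vec set) = CARD('f) ^ n"
proof -
  have "bij_betw vec_of_list {xs :: 'f list. set xs \<subseteq> UNIV \<and> length xs = n} (carrier_vec n)"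
  proof (rule bij_betw_byWitness[where f' = list_of_vec])
    show "vec_of_list ` {xs :: 'f list. set xs \<subseteq> UNIV \<and> length xs = n} \<subseteq> carrier_vec n"
      by (auto intro: carrier_vecI)
  qed (auto simp: list_vec vec_list)
  then show ?thesis
    using card_lists_length_eq[of "UNIV :: 'f set" n] by (simp add: bij_betw_same_card)
qed

lemma card_carrier_mat: "card (carrier_mat a b :: 'f::finite mat set) = CARD('f) ^ (a * b)"
proof -
  have "bij_betw (mat_of_rows b) {rs :: 'f vec list. set rs \<subseteq> carrier_vec b \<and> length rs = a}
          (carrier_mat a b)"
  proof (rule bij_betw_byWitness[where f' = rows])
    show "\<forall>rs\<in>{rs :: 'f vec list. set rs \<subseteq> carrier_vec b \<and> length rs = a}. rows (mat_of_rows b rs) = rs"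
      by (auto intro!: rows_mat_of_rows)
    show "rows ` carrier_mat a b \<subseteq> {rs :: 'f vec list. set rs \<subseteq> carrier_vec b \<and> length rs = a}"
      by (auto simp: rows_def)
  qed auto
  then show ?thesis
    using card_lists_length_eq[OF finite_carrier_vec_finite[where 'f = 'f and n = b], of a]
    by (simp add: bij_betw_same_card card_carrier_vec power_mult mult.commute[of a])
qed

lemma inj_on_mult_mat_vecI:
  fixes P :: "'f::field mat"
  assumes P: "P \<in> carrier_mat a k"
    and ker: "\<And>x. x \<in> carrier_vec k \<Longrightarrow> P *\<^sub>v x = 0\<^sub>v a \<Longrightarrow> x = 0\<^sub>v k"
  shows "inj_on ((*\<^sub>v) P) (carrier_vec k)"
proof (rule inj_onI)
  fix x y assume x: "x \<in> carrier_vec k" and y: "y \<in> carrier_vec k" and eq: "P *\<^sub>v x = P *\<^sub>v y"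
  have "P *\<^sub>v (x - y) = 0\<^sub>v a"
    using P x y eq by (auto simp: mult_minus_distrib_mat_vec)
  then have "x - y = 0\<^sub>v k" using ker x y by simp
  then have "\<And>i. i < k \<Longrightarrow> x $ i - y $ i = 0"
    using x y by (metis carrier_vecD index_minus_vec(1) index_zero_vec(1))
  then show "x = y" using x y by (intro eq_vecI) auto
qed

text \<open>Bridge from the locale dimension of \<open>U\<close> to counting: with a basis of
  \<open>U\<close> as columns, generation makes \<open>P\<close> map onto \<open>U\<close> and
  independence makes it injective, so \<open>U\<close> is a copy of a coordinate space.\<close>

lemma subspace_basis_matrix:
  fixes U :: "'f::{finite,field} vec set"
  assumes "VectorSpace.subspace class_ring U (module_vec TYPE('f) n)"
  shows "\<exists>P\<in>carrier_mat n (subspace_dim n U). bij_betw ((*\<^sub>v) P) (carrier_vec (subspace_dim n U)) U"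
proof -
  interpret vec_space "TYPE('f)" n .
  have sub: "submodule class_ring U V"
    using assms by (simp add: VectorSpace.subspace_def)
  have UV: "U \<subseteq> carrier_vec n"
    using sub by (auto simp: submodule_def module_vec_def)
  have finU: "finite U"
    using UV finite_carrier_vec_finite finite_subset by blast
  interpret W: vectorspace class_ring "vs U"
    using subspace_is_vs[OF assms] .
  have spanU: "W.span U = U"
    using W.in_own_span[of U] W.span_is_subset2[of U] by auto
  \<comment> \<open>Over a finite field \<open>U\<close> is itself a finite spanning set.\<close>
  have "W.fin_dim"
    unfolding W.fin_dim_def using finU spanU by auto
  then obtain B where B: "finite B" "W.basis B"
    using W.finite_basis_exists by blast
  have BU: "B \<subseteq> U" and li: "W.lin_indpt B" and gen: "W.span B = U"
    using B by (auto simp: W.basis_def)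
  have dimB: "subspace_dim n U = card B"
    unfolding subspace_dim_def using W.dim_basis[OF B] .
  \<comment> \<open>Independence and span pass from \<open>U\<close>, seen as a space of its own, to
    the ambient space in which the columns of \<open>P\<close> live.\<close>
  have li': "lin_indpt B" and gen': "span B = U"
    using span_li_not_depend[OF BU sub] li gen by auto
  obtain k where k: "k = subspace_dim n U" by blast
  obtain bs where bs: "set bs = B" "distinct bs"
    using finite_distinct_list[OF B(1)] by blast
  define P where "P = mat_of_cols n bs"
  have cols: "cols P = bs"
    using BU UV bs by (auto simp: P_def intro!: cols_mat_of_cols)
  have len: "length bs = k"
    using bs dimB k distinct_card by metis
  have P: "P \<in> carrier_mat n (k)"
    by (simp add: P_def flip: len)
  have "col_space P = U"
    unfolding col_space_def cols bs(1) by (rule gen')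
  moreover have "col_space P = {y \<in> carrier_vec n. \<exists>x\<in>carrier_vec k. P *\<^sub>v x = y}"
    using col_space_eq[OF P] carrier_matD[OF P] by metis
  moreover have "(*\<^sub>v) P ` carrier_vec k = {y \<in> carrier_vec n. \<exists>x\<in>carrier_vec k. P *\<^sub>v x = y}"
    using P by auto
  ultimately have "(*\<^sub>v) P ` carrier_vec k = U"
    by simp
  moreover have "inj_on ((*\<^sub>v) P) (carrier_vec k)"
    using lin_depI[OF P] cols bs li' by (intro inj_on_mult_mat_vecI[OF P]) auto
  ultimately show ?thesis using P by (auto simp: bij_betw_def k)
qed

lemma card_subspace:
  fixes U :: "'f::{finite,field} vec set"
  assumes "VectorSpace.subspace class_ring U (module_vec TYPE('f) n)"
  shows "card U = CARD('f) ^ subspace_dim n U"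
  using subspace_basis_matrix[OF assms] bij_betw_same_card by (fastforce simp flip: card_carrier_vec)

text \<open>This is the column space, recast as the image of a map so that it can be counted through
  injectivity and fibres.\<close>

definition mat_image :: "'f::field mat \<Rightarrow> 'f vec set" where
  "mat_image X = (*\<^sub>v) X ` carrier_vec (dim_col X)"

lemma mat_image_subset: "X \<in> carrier_mat a b \<Longrightarrow> mat_image X \<subseteq> carrier_vec a"
  by (auto simp: mat_image_def)

lemma mat_image_eq_col_space:
  "mat_image X = vec_space.col_space (dim_row X) (X :: 'f::field mat)"
  using vec_space.col_space_eq[of X "dim_row X" "dim_col X"]     mult_mat_vec_carrier[of X "dim_row X" "dim_col X"]
  by (auto simp: mat_image_def)

lemma subspace_mat_image:
  fixes X :: "'f::field mat"
  assumes "X \<in> carrier_mat a b"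
  shows "VectorSpace.subspace class_ring (mat_image X) (module_vec TYPE('f) a)"
proof -
  interpret vec_space "TYPE('f)" a .
  have "set (cols X) \<subseteq> carrier_vec a" using cols_dim assms by blast
  then have "VectorSpace.subspace class_ring (span (set (cols X))) V" by (intro span_is_subspace) auto
  then show ?thesis
    using assms by (simp add: mat_image_eq_col_space col_space_def)
qed

lemma mat_rank_eq_subspace_dim:
  fixes X :: "'f::field mat"
  shows "mat_rank X = subspace_dim (dim_row X) (mat_image X)"
  unfolding mat_rank_def subspace_dim_def mat_image_eq_col_space vec_space.rank_def vec_space.col_space_def ..

lemma card_mat_image:
  fixes X :: "'f::{finite,field} mat"
  shows "card (mat_image X) = CARD('f) ^ mat_rank X"
  using card_subspace[OF subspace_mat_image[of X "dim_row X" "dim_col X"]]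
  by (simp add: mat_rank_eq_subspace_dim)

lemma CARD_field_gt_1: "CARD('f::{finite,field}) > 1"
proof -
  have "card {0, 1 :: 'f} \<le> CARD('f)" by (intro card_mono) auto
  then show ?thesis by simp
qed

lemma mat_rank_leI:
  fixes X :: "'f::{finite,field} mat"
  assumes "card (mat_image X) \<le> CARD('f) ^ k"
  shows "mat_rank X \<le> k"
  using assms CARD_field_gt_1[where 'f = 'f] unfolding card_mat_image by simp

lemma mat_rank_eqI:
  fixes X :: "'f::{finite,field} mat"
  assumes "card (mat_image X) = CARD('f) ^ k"
  shows "mat_rank X = k"
  using assms CARD_field_gt_1[where 'f = 'f] unfolding card_mat_image by simp

section \<open>Rank-nullity, rank factorization and rank inequalities\<close>

lemma mat_image_mult_subset:
  assumes "P \<in> carrier_mat a k" "Q \<in> carrier_mat k b"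
  shows "mat_image (P * Q) \<subseteq> mat_image P"
  using assms by (auto simp: mat_image_def)

text \<open>Rank-nullity in multiplicative form: each nonempty fibre of multiplication by
  \<open>X\<close> is a translate of the kernel by a fixed preimage \<open>x0\<close>, so all fibres
  have the same size.\<close>

lemma card_image_times_card_mat_kernel:
  fixes X :: "'f::{finite,field} mat"
  assumes X: "X \<in> carrier_mat a b"
  shows "CARD('f) ^ mat_rank X * card (mat_kernel X) = CARD('f) ^ b"
proof -
  have fin: "finite (carrier_vec b :: 'f vec set)" by (rule finite_carrier_vec_finite)
  have fibre: "card {x \<in> carrier_vec b. X *\<^sub>v x = y} = card (mat_kernel X)" if y: "y \<in> mat_image X" for y
  proof -
    obtain x0 where x0: "x0 \<in> carrier_vec b" "X *\<^sub>v x0 = y"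
      using y X by (auto simp: mat_image_def)
    have "bij_betw (\<lambda>x. x - x0) {x \<in> carrier_vec b. X *\<^sub>v x = y} (mat_kernel X)"
      by (rule bij_betw_byWitness[where f' = "\<lambda>x. x + x0"])
        (use X x0 in \<open>auto simp: mat_kernel_def mult_minus_distrib_mat_vec mult_add_distrib_mat_vec\<close>)
    then show ?thesis by (rule bij_betw_same_card)
  qed
  have "CARD('f) ^ b = (\<Sum>x\<in>(carrier_vec b :: 'f vec set). 1 :: nat)"
    by (simp add: card_carrier_vec)
  also have "\<dots> = (\<Sum>y\<in>mat_image X. \<Sum>x | x \<in> carrier_vec b \<and> X *\<^sub>v x = y. 1)"
    using sum.image_gen[OF fin, of "\<lambda>_. 1 :: nat" "(*\<^sub>v) X"] X by (simp add: mat_image_def)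
  also have "\<dots> = card (mat_image X) * card (mat_kernel X)"
    using fibre by simp
  finally show ?thesis by (simp add: card_mat_image)
qed

text \<open>The columns of \<open>P\<close> are a basis of the column space, and column
  \<open>j\<close> of \<open>Q\<close> holds the coordinates of column \<open>j\<close> of
  \<open>X\<close>. The inner dimension \<open>mat_rank X\<close> is what bounds the rank of the
  transpose.\<close>

lemma mat_rank_factorization:
  fixes X :: "'f::{finite,field} mat"
  assumes X: "X \<in> carrier_mat a b"
  obtains P Q where "P \<in> carrier_mat a (mat_rank X)" "Q \<in> carrier_mat (mat_rank X) b" "X = P * Q"
proof -
  obtain P where P: "P \<in> carrier_mat a (mat_rank X)"
    and bij: "bij_betw ((*\<^sub>v) P) (carrier_vec (mat_rank X)) (mat_image X)"
    using subspace_basis_matrix[OF subspace_mat_image[OF X]] X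
    by (auto simp: mat_rank_eq_subspace_dim)
  have "\<exists>z\<in>carrier_vec (mat_rank X). P *\<^sub>v z = col X j" if "j < b" for j
  proof -
    have "X *\<^sub>v unit_vec b j = col X j" using X that by (intro eq_vecI) auto
    then have "col X j \<in> mat_image X"
      using X unit_vec_carrier[of b j] unfolding mat_image_def by (metis carrier_matD(2) imageI)
    then show ?thesis using bij by (metis bij_betw_imp_surj_on imageE)
  qed
  then obtain z where z: "\<And>j. j < b \<Longrightarrow> z j \<in> carrier_vec (mat_rank X) \<and> P *\<^sub>v z j = col X j"
    by metis
  define Q where "Q = mat_of_cols (mat_rank X) (map z [0..<b])"
  have Q: "Q \<in> carrier_mat (mat_rank X) b" by (simp add: Q_def carrier_matI)
  have "X = P * Q"
  proof (rule eq_matI)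
    fix i j assume "i < dim_row (P * Q)" "j < dim_col (P * Q)"
    then have i: "i < a" and j: "j < b" using P Q by auto
    have "col Q j = z j" using j z by (simp add: Q_def)
    then have "(P * Q) $$ (i, j) = (P *\<^sub>v z j) $ i" using P Q i j by simp
    then show "X $$ (i, j) = (P * Q) $$ (i, j)" using z[OF j] X i j by simp
  qed (use X P Q in auto)
  then show ?thesis using that P Q by blast
qed

lemma mat_rank_le_dim_col:
  fixes X :: "'f::{finite,field} mat"
  assumes "X \<in> carrier_mat a b"
  shows "mat_rank X \<le> b"
proof (rule mat_rank_leI)
  show "card (mat_image X) \<le> CARD('f) ^ b"
    using card_image_le[OF finite_carrier_vec_finite[of b], of "(*\<^sub>v) X"] assms
    by (simp add: mat_image_def card_carrier_vec)
qed

lemma finite_mat_image: "finite (mat_image (X :: 'f::{finite,field} mat))"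
  by (simp add: mat_image_def finite_carrier_vec_finite)

lemma mat_rank_mult_le:
  fixes P :: "'f::{finite,field} mat"
  assumes "P \<in> carrier_mat a k" "Q \<in> carrier_mat k b"
  shows "mat_rank (P * Q) \<le> mat_rank P"
  using card_mono[OF finite_mat_image mat_image_mult_subset[OF assms]]
  by (auto intro: mat_rank_leI simp: card_mat_image)

text \<open>Transposing a rank factorization puts \<open>Q\<^sup>T\<close> in front, and it has only
  \<open>mat_rank Y\<close> columns. This gives one inequality, and applying it to the transpose
  gives the other.\<close>

lemma mat_rank_transpose:
  fixes X :: "'f::{finite,field} mat"
  shows "mat_rank X\<^sup>T = mat_rank X"
proof -
  have le: "mat_rank Y\<^sup>T \<le> mat_rank Y" for Y :: "'f mat"
  proof -
    obtain P Q where PQ: "P \<in> carrier_mat (dim_row Y) (mat_rank Y)"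
      "Q \<in> carrier_mat (mat_rank Y) (dim_col Y)" "Y = P * Q"
      using mat_rank_factorization[of Y "dim_row Y" "dim_col Y"] by auto
    have "Y\<^sup>T = Q\<^sup>T * P\<^sup>T" using PQ transpose_mult by metis
    moreover have "mat_rank (Q\<^sup>T * P\<^sup>T) \<le> mat_rank Q\<^sup>T"
      by (rule mat_rank_mult_le) (use PQ(1,2) in auto)
    ultimately have "mat_rank Y\<^sup>T \<le> mat_rank Q\<^sup>T" by simp
    also have "\<dots> \<le> mat_rank Y"
      by (rule mat_rank_le_dim_col) (use PQ(2) in auto)
    finally show ?thesis .
  qed
  show ?thesis using le[of X] le[of "X\<^sup>T"] by simp
qed

lemma mat_rank_le_dim_row:
  fixes X :: "'f::{finite,field} mat"
  assumes "X \<in> carrier_mat a b"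
  shows "mat_rank X \<le> a"
  using mat_rank_le_dim_col[of "X\<^sup>T" b a] assms by (simp add: mat_rank_transpose)

text \<open>Each vector in the image of \<open>X - Y\<close> is a difference of vectors from the two
  images; bounding it by the number of pairs turns a product of cardinalities into a sum of
  ranks.\<close>

lemma mat_rank_minus_le:
  fixes X Y :: "'f::{finite,field} mat"
  assumes X: "X \<in> carrier_mat a b" and Y: "Y \<in> carrier_mat a b"
  shows "mat_rank (X - Y) \<le> mat_rank X + mat_rank Y"
proof (rule mat_rank_leI)
  have "mat_image (X - Y) \<subseteq> (\<lambda>(x, y). x - y) ` (mat_image X \<times> mat_image Y)"
    using X Y by (auto simp: mat_image_def minus_mult_distrib_mat_vec)
  then have "card (mat_image (X - Y)) \<le> card (mat_image X \<times> mat_image Y)"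
    by (meson card_image_le card_mono finite_SigmaI finite_imageI finite_mat_image le_trans)
  then show "card (mat_image (X - Y)) \<le> CARD('f) ^ (mat_rank X + mat_rank Y)"
    by (simp add: card_cartesian_product card_mat_image power_add)
qed

lemma mat_rank_zero: "mat_rank (0\<^sub>m a b :: 'f::{finite,field} mat) = 0"
proof -
  interpret vec_space "TYPE('f)" a .
  show ?thesis by (simp add: mat_rank_def rank_0I)
qed

lemma mat_rank_eq_0_iff:
  fixes X :: "'f::{finite,field} mat"
  assumes X: "X \<in> carrier_mat a b"
  shows "mat_rank X = 0 \<longleftrightarrow> X = 0\<^sub>m a b"
proof
  assume "mat_rank X = 0"
  then obtain P Q where "P \<in> carrier_mat a 0" "Q \<in> carrier_mat 0 b" "X = P * Q"
    using mat_rank_factorization[OF X] by metis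
  then show "X = 0\<^sub>m a b" by (intro eq_matI) (auto simp: scalar_prod_def)
qed (simp add: mat_rank_zero)

section \<open>Elementary bounds on rank-metric codes\<close>

text \<open>A large kernel forces a small rank, as the Singleton bound needs. The companion estimate
  below serves the Gabidulin codes, where the kernel is bounded by a number of roots.\<close>

lemma mat_rank_le_of_card_kernel:
  fixes X :: "'f::{finite,field} mat"
  assumes "X \<in> carrier_mat a b" and "CARD('f) ^ k \<le> card (mat_kernel X)"
  shows "mat_rank X + k \<le> b"
proof -
  have "CARD('f) ^ (mat_rank X + k) \<le> CARD('f) ^ b"
    using card_image_times_card_mat_kernel[OF assms(1)] assms(2)
    by (metis mult_le_mono2 power_add)
  then show ?thesis using CARD_field_gt_1[where 'f = 'f] by simp
qed

lemma mat_rank_ge_of_card_kernel: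
  fixes X :: "'f::{finite,field} mat"
  assumes "X \<in> carrier_mat a b" and "card (mat_kernel X) \<le> CARD('f) ^ k"
  shows "b \<le> mat_rank X + k"
proof -
  have "CARD('f) ^ b \<le> CARD('f) ^ (mat_rank X + k)"
    using card_image_times_card_mat_kernel[OF assms(1)] assms(2)
    by (metis mult_le_mono2 power_add)
  then show ?thesis using CARD_field_gt_1[where 'f = 'f] by simp
qed

section \<open>Maximal codes, transposition and the Singleton bound\<close>

lemma card_le_Lambda:
  "rank_metric_code a b d u (C :: 'f::{finite,field} mat set) \<Longrightarrow> card C \<le> Lambda TYPE('f) a b d u"
  unfolding Lambda_def using Lambda_Max_wf(1)[of a b d u] by (intro Max_ge) auto

lemma Lambda_attained:
  obtains C :: "'f::{finite,field} mat set"
  where "rank_metric_code a b d u C" "card C = Lambda TYPE('f) a b d u"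
proof -
  have "Lambda TYPE('f) a b d u \<in> card ` {C :: 'f mat set. rank_metric_code a b d u C}"
    unfolding Lambda_def using Lambda_Max_wf[of a b d u] by (intro Max_in) auto
  then show ?thesis using that by auto
qed

lemma finite_rank_metric_code:
  "rank_metric_code a b d u (C :: 'f::{finite,field} mat set) \<Longrightarrow> finite C"
  unfolding rank_metric_code_def using finite_carrier_mat_finite finite_subset by blast

lemma rank_metric_code_transpose:
  fixes C :: "'f::{finite,field} mat set"
  assumes "rank_metric_code a b d u C"
  shows "rank_metric_code b a d u (transpose_mat ` C)"
proof -
  have "d \<le> mat_rank (X\<^sup>T - Y\<^sup>T)" if "X \<in> C" "Y \<in> C" "X\<^sup>T \<noteq> Y\<^sup>T" for X Y
  proof -
    have "X \<in> carrier_mat a b" "Y \<in> carrier_mat a b"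
      using that assms by (auto simp: rank_metric_code_def)
    then have "X\<^sup>T - Y\<^sup>T = (X - Y)\<^sup>T"
      by (intro eq_matI) auto
    then show ?thesis
      using that assms by (auto simp: rank_metric_code_def mat_rank_transpose)
  qed
  then show ?thesis
    using assms by (auto simp: rank_metric_code_def mat_rank_transpose)
qed

text \<open>Since transposition preserves rank distances, statements in \<open>min a b\<close> and
  \<open>max a b\<close> reduce to one order of the sides.\<close>

lemma Lambda_commute: "Lambda TYPE('f::{finite,field}) a b d u = Lambda TYPE('f) b a d u"
proof -
  have "Lambda TYPE('f) a b d u \<le> Lambda TYPE('f) b a d u" for a b
  proof -
    obtain C :: "'f mat set" where C: "rank_metric_code a b d u C" "card C = Lambda TYPE('f) a b d u"
      by (rule Lambda_attained)
    have "inj_on transpose_mat C" by (metis inj_onI transpose_transpose)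
    then show ?thesis
      using card_le_Lambda[OF rank_metric_code_transpose[OF C(1)]] C(2) by (simp add: card_image)
  qed
  then show ?thesis by (meson le_antisym)
qed

lemma Lambda_ge_1: "1 \<le> Lambda TYPE('f::{finite,field}) a b d u"
proof -
  have "rank_metric_code a b d u {0\<^sub>m a b :: 'f mat}"
    by (simp add: rank_metric_code_def mat_rank_zero)
  then show ?thesis using card_le_Lambda by fastforce
qed

text \<open>The difference of two codewords has rank at most \<open>2 * u\<close>, \<open>a\<close>
  and \<open>b\<close>; if one of these is below \<open>d\<close>, a code has at most one element,
  and the zero matrix alone is a code.\<close>

lemma Lambda_eq_1:
  assumes "2 * u < d \<or> min a b < d"
  shows "Lambda TYPE('f::{finite,field}) a b d u = 1"
proof -
  obtain C :: "'f mat set" where C: "rank_metric_code a b d u C" "card C = Lambda TYPE('f) a b d u"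
    by (rule Lambda_attained)
  have "X = Y" if "X \<in> C" "Y \<in> C" for X Y
  proof (rule ccontr)
    assume "X \<noteq> Y"
    then have X: "X \<in> carrier_mat a b" "mat_rank X \<le> u" and Y: "Y \<in> carrier_mat a b" "mat_rank Y \<le> u"
      and d: "d \<le> mat_rank (X - Y)"
      using that C by (auto simp: rank_metric_code_def)
    have XY: "X - Y \<in> carrier_mat a b" using X Y by auto
    show False
      using d X Y assms mat_rank_minus_le[OF X(1) Y(1)] mat_rank_le_dim_col[OF XY]
        mat_rank_le_dim_row[OF XY] by auto
  qed
  then have "card C \<le> 1" using finite_rank_metric_code[OF C(1)] by (auto simp: card_le_Suc0_iff_eq)
  then show ?thesis using C Lambda_ge_1[where 'f = 'f, of a b d u] by simp
qed

text \<open>This holds for either order of the sides, but the exponent is the smaller one when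
  \<open>a\<close> is the larger side; it is applied in that order to match the Gabidulin
  codes.\<close>

lemma Lambda_le_Singleton:
  assumes "0 < d" "d \<le> b"
  shows "Lambda TYPE('f::{finite,field}) a b d u \<le> CARD('f) ^ (a * (b - d + 1))"
proof -
  obtain C :: "'f mat set" where C: "rank_metric_code a b d u C" "card C = Lambda TYPE('f) a b d u"
    by (rule Lambda_attained)
  define k where "k = b - d + 1"
  define trunc where "trunc X = mat a k (\<lambda>ij. X $$ ij)" for X :: "'f mat"
  have kb: "k \<le> b" using assms by (simp add: k_def)
  have "inj_on trunc C"
  proof (rule inj_onI, rule ccontr)
    fix X Y assume XC: "X \<in> C" and YC: "Y \<in> C" and eq: "trunc X = trunc Y" and ne: "X \<noteq> Y"
    have X: "X \<in> carrier_mat a b" and Y: "Y \<in> carrier_mat a b"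
      using XC YC C by (auto simp: rank_metric_code_def)
    have XY: "X - Y \<in> carrier_mat a b" using X Y by auto
    have zero: "(X - Y) $$ (i, j) = 0" if "i < a" "j < k" for i j
    proof -
      have "trunc X $$ (i, j) = trunc Y $$ (i, j)" by (simp add: eq)
      then show ?thesis using that kb X Y by (simp add: trunc_def)
    qed
    \<comment> \<open>Codewords that agree after truncation have a difference whose first
      \<open>k\<close> columns vanish, so all vectors supported on the first \<open>k\<close>
      coordinates lie in its kernel. This leaves rank at most \<open>b - k = d - 1\<close>.\<close>
    define pad where "pad x = vec b (\<lambda>j. if j < k then x $ j else 0)" for x :: "'f vec"
    obtain D where D: "D = X - Y" by blast
    have "pad x \<in> mat_kernel (X - Y)" for x
    proof (rule mat_kernelI[OF XY])
      have "D *\<^sub>v pad x = 0\<^sub>v a"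
      proof (rule eq_vecI)
        fix i assume "i < dim_vec (0\<^sub>v a :: 'f vec)"
        then have i: "i < a" by simp
        then have "(D *\<^sub>v pad x) $ i = (\<Sum>j = 0..<b. D $$ (i, j) * (if j < k then x $ j else 0))"
          using XY by (simp flip: D) (simp add: scalar_prod_def pad_def)
        also have "\<dots> = 0" using zero[OF i] D by (intro sum.neutral) auto
        finally show "(D *\<^sub>v pad x) $ i = 0\<^sub>v a $ i" using i by simp
      qed (use XY D in auto)
      then show "(X - Y) *\<^sub>v pad x = 0\<^sub>v a" by (simp add: D)
    qed (simp add: pad_def)
    then have "pad ` carrier_vec k \<subseteq> mat_kernel (X - Y)" by blast
    moreover have "inj_on pad (carrier_vec k)"
    proof (rule inj_onI)
      fix x y :: "'f vec" assume xy: "x \<in> carrier_vec k" "y \<in> carrier_vec k" "pad x = pad y"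
      have "x $ j = y $ j" if "j < k" for j
        using arg_cong[OF xy(3), of "\<lambda>v. v $ j"] that kb by (simp add: pad_def)
      then show "x = y" using xy by (intro eq_vecI) auto
    qed
    moreover have "finite (mat_kernel (X - Y))"
      using mat_kernel_carrier[OF XY] finite_carrier_vec_finite finite_subset by blast
    ultimately have "CARD('f) ^ k \<le> card (mat_kernel (X - Y))"
      by (metis card_image card_mono card_carrier_vec)
    then have "mat_rank (X - Y) + k \<le> b" by (rule mat_rank_le_of_card_kernel[OF XY])
    moreover have "d \<le> mat_rank (X - Y)" using C XC YC ne by (auto simp: rank_metric_code_def)
    ultimately show False using assms by (simp add: k_def)
  qed
  moreover have "trunc ` C \<subseteq> carrier_mat a k" by (auto simp: trunc_def)
  ultimately have "card C \<le> card (carrier_mat a k :: 'f mat set)"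
    by (intro card_inj_on_le finite_carrier_mat_finite)
  then show ?thesis using C(2) by (simp add: card_carrier_mat k_def)
qed

section \<open>Finite extension fields and Gabidulin codes\<close>

text \<open>Multiplication by a nonzero \<open>x\<close> permutes the nonzero elements; comparing
  their products gives x^(q-1) = 1.\<close>

lemma power_CARD_eq_self:
  fixes x :: "'f::{finite,field}"
  shows "x ^ CARD('f) = x"
proof (cases "x = 0")
  case True
  then show ?thesis using CARD_field_gt_1[where 'f = 'f] by simp
next
  case False
  have "bij_betw ((*) x) (UNIV - {0}) (UNIV - {0})"
    by (rule bij_betw_byWitness[where f' = "\<lambda>y. y / x"]) (use False in auto)
  then have "(\<Prod>y\<in>UNIV - {0}. x * y) = \<Prod>(UNIV - {0})"
    by (rule prod.reindex_bij_betw)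
  then have "x ^ (CARD('f) - 1) * \<Prod>(UNIV - {0}) = \<Prod>(UNIV - {0})"
    by (simp add: prod.distrib)
  moreover have "\<Prod>(UNIV - {0 :: 'f}) \<noteq> 0" by simp
  ultimately have "x ^ (CARD('f) - 1) = 1" by simp
  then show ?thesis
    using CARD_field_gt_1[where 'f = 'f] by (subst power_eq_if) simp
qed

lemma CARD_eq_CHAR_power:
  assumes "primepow CARD('f::{finite,field})"
  obtains k where "prime CHAR('f)" "CARD('f) = CHAR('f) ^ k" "k > 0"
proof -
  obtain p k where pk: "prime p" "k > 0" "CARD('f) = p ^ k"
    using assms by (auto simp: primepow_def)
  have CH: "prime CHAR('f)"
    using finite_imp_CHAR_pos[where 'a = 'f] by (intro prime_CHAR_semidom) auto
  moreover have "CHAR('f) dvd p ^ k" using CHAR_dvd_CARD[where 'a = 'f] pk by simp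
  ultimately have "CHAR('f) = p"
    using pk(1) by (meson prime_dvd_power primes_dvd_imp_eq)
  then show ?thesis using that CH pk by simp
qed

text \<open>As \<open>CARD('f)\<close> is a power of the characteristic, raising to a power of it is
  an iterated Frobenius map and hence additive.\<close>

lemma Frobenius_sum:
  fixes f :: "'b \<Rightarrow> 'f::{finite,field} alg_closure"
  assumes "primepow CARD('f)"
  shows "sum f A ^ (CARD('f) ^ i) = (\<Sum>x\<in>A. f x ^ (CARD('f) ^ i))"
proof -
  obtain k where "prime CHAR('f)" "CARD('f) = CHAR('f) ^ k"
    using CARD_eq_CHAR_power[OF assms] by metis
  then show ?thesis
    by (intro freshmans_dream_sum'[of _ "k * i"]) (auto simp: power_mult)
qed

lemma Frobenius_add:
  fixes x y :: "'f::{finite,field} alg_closure"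
  assumes "primepow CARD('f)"
  shows "(x + y) ^ (CARD('f) ^ i) = x ^ (CARD('f) ^ i) + y ^ (CARD('f) ^ i)"
  using Frobenius_sum[OF assms, of "\<lambda>b. if b then x else y" UNIV i] by (simp add: UNIV_bool add.commute)

lemma to_ac_power_CARD:
  "to_ac (c :: 'f::{finite,field}) ^ (CARD('f) ^ i) = to_ac c"
proof (induction i)
  case (Suc i)
  then show ?case
    by (metis power_CARD_eq_self power_Suc2 power_mult to_ac_power)
qed simp

text \<open>The field with q^n elements, as the fixed points of the \<open>n\<close>-fold power of
  the \<open>q\<close>-Frobenius.\<close>

definition ext_field :: "nat \<Rightarrow> 'f::{finite,field} alg_closure set" where
  "ext_field n = {x. x ^ (CARD('f) ^ n) = x}"

text \<open>The polynomial x^N - x splits over the algebraic closure, and its derivative is the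
  constant -1 because \<open>N\<close> vanishes in the characteristic. So there is no repeated root
  and the number of roots equals the degree.\<close>

lemma card_ext_field:
  assumes q: "primepow CARD('f::{finite,field})" and n: "n > 0"
  shows "card (ext_field n :: 'f alg_closure set) = CARD('f) ^ n"
proof -
  define N where "N = CARD('f) ^ n"
  have N: "N > 1" unfolding N_def by (rule one_less_power[OF CARD_field_gt_1 n])
  define p :: "'f alg_closure poly" where "p = monom 1 N - monom 1 1"
  have deg: "degree p = N"
    unfolding p_def diff_conv_add_uminus using N
    by (subst degree_add_eq_left) (simp_all add: degree_monom_eq)
  have p0: "p \<noteq> 0" using deg N by auto
  have roots: "{x. poly p x = 0} = ext_field n"
    by (auto simp: p_def poly_monom ext_field_def N_def)
  obtain k where k: "prime CHAR('f)" "CARD('f) = CHAR('f) ^ k" "k > 0"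
    using CARD_eq_CHAR_power[OF q] by metis
  have "CHAR('f) dvd N" unfolding N_def k(2) using k(3) n by (simp add: dvd_power flip: power_mult)
  then have "of_nat N = (0 :: 'f alg_closure)" by (simp add: of_nat_eq_0_iff_char_dvd)
  then have deriv: "poly (pderiv p) x = -1" for x
    by (simp add: p_def pderiv_diff pderiv_monom poly_monom)
  obtain A where A: "size A = degree p" "p = smult (lead_coeff p) (\<Prod>x\<in>#A. [:-x, 1:])"
    using alg_closed_imp_factorization[OF p0] by blast
  have lin: "count A x \<le> 1" for x
  proof (rule ccontr)
    assume "\<not> count A x \<le> 1"
    then have "{#x, x#} \<subseteq># A" by (auto simp: subseteq_mset_def)
    \<comment> \<open>A linear factor occurring twice would make the derivative vanish at
      \<open>x\<close>.\<close>
    then obtain B where "A = {#x, x#} + B" by (metis mset_subset_eq_exists_conv)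
    then have "p = [:-x, 1:] * ([:-x, 1:] * smult (lead_coeff p) (\<Prod>x\<in>#B. [:-x, 1:]))"
      using A(2) by (simp add: mult_ac)
    then obtain l r where "p = l * (l * r)" "poly l x = 0" by fastforce
    then have "poly (pderiv p) x = 0" by (simp add: pderiv_mult)
    then show False using deriv[of x] by simp
  qed
  have "A = mset_set (set_mset A)"
  proof (rule multiset_eqI)
    fix x
    have "count A x = (if x \<in># A then 1 else 0)"
      using lin[of x] count_greater_zero_iff[of A x] by (auto simp: not_in_iff simp del: count_greater_zero_iff)
    then show "count A x = count (mset_set (set_mset A)) x"
      by (simp only: count_mset_set' finite_set_mset simp_thms)
  qed
  then have "card (set_mset A) = N" using A(1) deg by (metis size_mset_set)
  moreover have "set_mset A \<subseteq> {x. poly p x = 0}"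
  proof
    fix x assume "x \<in># A"
    then obtain B where "A = add_mset x B" by (metis insert_DiffM)
    then have "poly (\<Prod>y\<in>#A. [:-y, 1:]) x = 0" by simp
    then have "poly (smult (lead_coeff p) (\<Prod>y\<in>#A. [:-y, 1:])) x = 0" by simp
    then show "x \<in> {x. poly p x = 0}" using A(2) by simp
  qed
  ultimately have "N \<le> card {x. poly p x = 0}"
    using card_mono[OF poly_roots_finite[OF p0]] by metis
  then show ?thesis using card_poly_roots_bound[OF p0] deg roots by (simp add: N_def)
qed

lemma ext_field_closed:
  fixes x y :: "'f::{finite,field} alg_closure" and c :: 'f
  assumes "primepow CARD('f)"
  shows "0 \<in> (ext_field n :: 'f alg_closure set)"
    and "x \<in> ext_field n \<Longrightarrow> y \<in> ext_field n \<Longrightarrow> x + y \<in> ext_field n"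
    and "x \<in> ext_field n \<Longrightarrow> y \<in> ext_field n \<Longrightarrow> x * y \<in> ext_field n"
    and "x \<in> ext_field n \<Longrightarrow> x ^ i \<in> ext_field n"
    and "to_ac c \<in> ext_field n"
proof -
  show "x ^ i \<in> ext_field n" if "x \<in> ext_field n"
  proof -
    have "(x ^ i) ^ (CARD('f) ^ n) = (x ^ (CARD('f) ^ n)) ^ i"
      by (simp only: power_mult[symmetric] mult.commute[of i])
    then show ?thesis using that by (simp add: ext_field_def)
  qed
  show "0 \<in> (ext_field n :: 'f alg_closure set)"
    using CARD_field_gt_1[where 'f = 'f] by (simp add: ext_field_def)
qed (use assms in \<open>auto simp: ext_field_def Frobenius_add power_mult_distrib to_ac_power_CARD\<close>)

lemma ext_field_sum:
  fixes f :: "'b \<Rightarrow> 'f::{finite,field} alg_closure"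
  assumes "primepow CARD('f)" and "\<And>i. i \<in> I \<Longrightarrow> f i \<in> ext_field n"
  shows "sum f I \<in> ext_field n"
  using assms by (simp add: ext_field_def Frobenius_sum)

lemma vector_space_alg_closure: "vector_space (\<lambda>(c :: 'f::field) x. to_ac c * x)"
proof 
  fix a b :: 'f and x y :: "'f alg_closure"
  show "to_ac a * (x + y) = to_ac a * x + to_ac a * y" by (simp add: distrib_left)
  show "to_ac (a + b) * x = to_ac a * x + to_ac b * x" by (simp add: distrib_right)
  show "to_ac a * (to_ac b * x) = to_ac (a * b) * x" by (simp add: mult.assoc)
  show "to_ac 1 * x = x" by simp
qed

text \<open>An abstract basis \<open>B\<close> gives a bijection between coefficient functions on
  \<open>B\<close> and the extension field. Comparing cardinalities forces
  \<open>card B = n\<close>, so \<open>B\<close> can be enumerated by the indices below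
  \<open>n\<close>.\<close>

lemma ext_field_basis:
  assumes q: "primepow CARD('f::{finite,field})" and n: "n > 0"
  obtains \<beta> :: "nat \<Rightarrow> 'f::{finite,field} alg_closure" where
    "\<forall>i<n. \<beta> i \<in> ext_field n"
    "\<forall>x\<in>ext_field n. \<exists>c. x = (\<Sum>i<n. to_ac (c i) * \<beta> i)"
    "\<forall>c. (\<Sum>i<n. to_ac (c i) * \<beta> i) = 0 \<longrightarrow> (\<forall>i<n. c i = 0)"
proof -
  define L :: "'f alg_closure set" where "L = ext_field n"
  interpret vs: vector_space "\<lambda>(c :: 'f) x. to_ac c * x"
    by (rule vector_space_alg_closure)
  have sub: "vs.subspace L"
    unfolding vs.subspace_def L_def by (intro conjI ballI allI ext_field_closed[OF q])
  have cardL: "card L = CARD('f) ^ n" unfolding L_def by (rule card_ext_field[OF q n])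
  then have finL: "finite L" by (intro card_ge_0_finite) simp
  obtain B where B: "B \<subseteq> L" "vs.independent B" "L \<subseteq> vs.span B"
    by (rule vs.basis_exists[of L])
  have finB: "finite B" using B(1) finL finite_subset by blast
  have spanB: "vs.span B = L" using B vs.span_minimal[OF B(1) sub] by blast
  define comb where "comb c = (\<Sum>b\<in>B. to_ac (c b) * b)" for c :: "'f alg_closure \<Rightarrow> 'f"
  have L_range: "L = range comb"
    unfolding comb_def vs.span_finite[OF finB, symmetric] by (rule spanB[symmetric])
  have indep: "c b = 0" if "comb c = 0" "b \<in> B" for c b
    using vs.independentD[OF B(2) finB subset_refl, of c b] that by (simp add: comb_def)
  have "bij_betw comb (B \<rightarrow>\<^sub>E UNIV) L"
    unfolding bij_betw_def
  proof
    show "inj_on comb (B \<rightarrow>\<^sub>E UNIV)"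
    proof (rule inj_onI)
      fix c c' assume c: "c \<in> B \<rightarrow>\<^sub>E UNIV" "c' \<in> B \<rightarrow>\<^sub>E UNIV" "comb c = comb c'"
      have "comb (\<lambda>b. c b - c' b) = 0"
        using c(3) by (simp add: comb_def left_diff_distrib sum_subtractf)
      then have "c b = c' b" if "b \<in> B" for b using indep[OF _ that] by fastforce
      then show "c = c'" using c by (intro PiE_ext) auto
    qed
    have "x \<in> comb ` (B \<rightarrow>\<^sub>E UNIV)" if "x \<in> L" for x
    proof -
      obtain c where "x = comb c"
        using \<open>x \<in> L\<close> L_range by blast
      moreover have "comb c = comb (restrict c B)" by (simp add: comb_def)
      ultimately show ?thesis by auto
    qed
    then show "comb ` (B \<rightarrow>\<^sub>E UNIV) = L" using L_range by blast
  qed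
  then have "CARD('f) ^ card B = CARD('f) ^ n"
    using finB cardL by (simp add: bij_betw_same_card[symmetric] card_PiE)
  then have "card B = n" using CARD_field_gt_1[where 'f = 'f] by simp
  then obtain \<beta> where \<beta>: "bij_betw \<beta> {..<n} B"
    using ex_bij_betw_nat_finite[OF finB] by (auto simp: atLeast0LessThan)
  have comb_eq: "comb c = (\<Sum>i<n. to_ac (c (\<beta> i)) * \<beta> i)" for c
    unfolding comb_def by (rule sum.reindex_bij_betw[OF \<beta>, symmetric])
  show ?thesis
  proof (rule that[of \<beta>]; intro allI ballI impI)
    show "\<beta> i \<in> ext_field n" if "i < n" for i
      using \<beta> B(1) that by (auto simp: bij_betw_def L_def)
    show "\<exists>c. x = (\<Sum>i<n. to_ac (c i) * \<beta> i)" if "x \<in> ext_field n" for x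
    proof -
      obtain c where "x = comb c"
        using \<open>x \<in> ext_field n\<close> L_range L_def by blast
      then show ?thesis by (intro exI[of _ "c \<circ> \<beta>"]) (simp add: comb_eq)
    qed
    show "c i = 0" if c: "(\<Sum>i<n. to_ac (c i) * \<beta> i) = 0" and i: "i < n" for c i
    proof -
      \<comment> \<open>The coefficients are carried from indices to basis elements, because
        independence is known for functions on \<open>B\<close>.\<close>
      define c' where "c' = c \<circ> inv_into {..<n} \<beta>"
      have c': "c' (\<beta> j) = c j" if "j < n" for j
        using \<beta> that by (simp add: c'_def bij_betw_def)
      then have "comb c' = 0" using c by (simp add: comb_eq)
      then show ?thesis using indep[of c' "\<beta> i"] \<beta> i c' by (auto simp: bij_betw_def)
    qed
  qed
qed

text \<open>Gabidulin codes: evaluate \<open>q\<close>-polynomials of \<open>q\<close>-degree below \<open>b - d + 1\<close> with coefficients in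
  the extension field of degree \<open>a\<close> at \<open>b\<close> linearly independent elements. A nonzero one vanishes on
  at most \<open>q ^ (b - d)\<close> points, so its matrix has rank at least \<open>d\<close>.\<close>

lemma Lambda_ge_Gabidulin:
  assumes q: "primepow CARD('f::{finite,field})" and "0 < d" "d \<le> b" "b \<le> a" "b \<le> u"
  shows "CARD('f) ^ (a * (b - d + 1)) \<le> Lambda TYPE('f) a b d u"
proof -
  define q where "q = CARD('f)"
  have q1: "q > 1" unfolding q_def by (rule CARD_field_gt_1)
  have a0: "a > 0" using assms by simp
  obtain \<beta> :: "nat \<Rightarrow> 'f alg_closure" where
    \<beta>: "\<forall>i<a. \<beta> i \<in> ext_field a"
    and span: "\<forall>x\<in>ext_field a. \<exists>c. x = (\<Sum>i<a. to_ac (c i) * \<beta> i)"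
    and indep: "\<forall>c. (\<Sum>i<a. to_ac (c i) * \<beta> i) = 0 \<longrightarrow> (\<forall>i<a. c i = 0)"
    by (rule ext_field_basis[OF assms(1) a0])
  \<comment> \<open>Coordinates in the basis \<open>\<beta>\<close>. The choice is meaningful only
    on \<open>ext_field a\<close>, which is why \<open>f_closed\<close> is needed before
    \<open>\<rho>\<close> can be applied to values of \<open>f c\<close>.\<close>
  define \<rho> where "\<rho> x = (SOME c. x = (\<Sum>i<a. to_ac (c i) * \<beta> i))" for x
  have \<rho>: "x = (\<Sum>i<a. to_ac (\<rho> x i) * \<beta> i)" if "x \<in> ext_field a" for x
    unfolding \<rho>_def by (rule someI_ex[OF bspec[OF span that]])
  \<comment> \<open>The index \<open>k\<close> is the top \<open>q\<close>-degree, so a codeword has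
    \<open>k + 1 = b - d + 1\<close> coefficients.\<close>
  define k where "k = b - d"
  define Co :: "(nat \<Rightarrow> 'f alg_closure) set" where "Co = {..k} \<rightarrow>\<^sub>E ext_field a"
  define f where "f c x = (\<Sum>i\<le>k. c i * x ^ (q ^ i))" for c and x :: "'f alg_closure"
  define X where "X c = mat a b (\<lambda>(i, j). \<rho> (f c (\<beta> j)) i)" for c
  define \<psi> where "\<psi> x = (\<Sum>j<b. to_ac (x $ j) * \<beta> j)" for x :: "'f vec"
  have Xc: "X c \<in> carrier_mat a b" for c by (simp add: X_def)
  have f_closed: "f c (\<beta> j) \<in> ext_field a" if "c \<in> Co" "j < b" for c j
    unfolding f_def
  proof (rule ext_field_sum[OF assms(1)])
    fix i assume "i \<in> {..k}"
    then have "c i \<in> ext_field a" using that(1) by (auto simp: Co_def)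
    then show "c i * \<beta> j ^ (q ^ i) \<in> ext_field a"
      using \<beta> that(2) assms(4) by (intro ext_field_closed[OF assms(1)]) auto
  qed
  \<comment> \<open>A \<open>q\<close>-polynomial is linear over the small field: the powers
    \<open>q ^ i\<close> are additive and fix the scalars \<open>to_ac (x $ j)\<close>.\<close>
  have f_lin: "f c (\<psi> x) = (\<Sum>j<b. to_ac (x $ j) * f c (\<beta> j))" for c x
  proof -
    have "f c (\<psi> x) = (\<Sum>i\<le>k. \<Sum>j<b. c i * (to_ac (x $ j) * \<beta> j ^ (q ^ i)))"
      unfolding f_def \<psi>_def q_def Frobenius_sum[OF assms(1)]
      by (simp add: power_mult_distrib to_ac_power_CARD sum_distrib_left)
    also have "\<dots> = (\<Sum>j<b. \<Sum>i\<le>k. c i * (to_ac (x $ j) * \<beta> j ^ (q ^ i)))"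
      by (rule sum.swap)
    also have "\<dots> = (\<Sum>j<b. to_ac (x $ j) * f c (\<beta> j))"
      by (simp add: f_def sum_distrib_left mult.left_commute)
    finally show ?thesis .
  qed
  \<comment> \<open>The matrix represents the evaluation: \<open>X c\<close> applied to
    \<open>x\<close> yields the coordinates of the value of \<open>f c\<close> at
    \<open>\<psi> x\<close>.\<close>
  have eval: "(\<Sum>i<a. to_ac ((X c *\<^sub>v x) $ i) * \<beta> i) = f c (\<psi> x)"
    if c: "c \<in> Co" and x: "x \<in> carrier_vec b" for c x
  proof -
    have "(X c *\<^sub>v x) $ i = (\<Sum>j<b. \<rho> (f c (\<beta> j)) i * x $ j)" if "i < a" for i
      using that x by (simp add: X_def scalar_prod_def atLeast0LessThan)
    then have "(\<Sum>i<a. to_ac ((X c *\<^sub>v x) $ i) * \<beta> i)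
        = (\<Sum>i<a. \<Sum>j<b. to_ac (x $ j) * (to_ac (\<rho> (f c (\<beta> j)) i) * \<beta> i))"
      by (simp add: to_ac_sum sum_distrib_left sum_distrib_right mult_ac)
    also have "\<dots> = (\<Sum>j<b. \<Sum>i<a. to_ac (x $ j) * (to_ac (\<rho> (f c (\<beta> j)) i) * \<beta> i))"
      by (rule sum.swap)
    also have "\<dots> = (\<Sum>j<b. to_ac (x $ j) * f c (\<beta> j))"
      by (intro sum.cong refl) (simp only: sum_distrib_left[symmetric] \<rho>[OF f_closed[OF c], symmetric] lessThan_iff)
    also have "\<dots> = f c (\<psi> x)" by (simp only: f_lin)
    finally show ?thesis .
  qed
  have \<psi>_inj: "inj_on \<psi> (carrier_vec b)"
  proof (rule inj_onI)
    fix x y :: "'f vec" assume x: "x \<in> carrier_vec b" and y: "y \<in> carrier_vec b" and eq: "\<psi> x = \<psi> y"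
    \<comment> \<open>The difference is extended by zeros to length \<open>a\<close>, so that
      independence of all of \<open>\<beta>\<close> applies to its first \<open>b\<close>
      members.\<close>
    define e where "e j = (if j < b then x $ j - y $ j else 0)" for j
    have "(\<Sum>j<a. to_ac (e j) * \<beta> j) = (\<Sum>j<b. to_ac (e j) * \<beta> j)"
      using assms(4) by (intro sum.mono_neutral_right) (auto simp: e_def)
    also have "\<dots> = \<psi> x - \<psi> y"
      by (simp add: \<psi>_def e_def left_diff_distrib sum_subtractf)
    finally have "(\<Sum>j<a. to_ac (e j) * \<beta> j) = 0" using eq by simp
    then have "e j = 0" if "j < b" for j using indep that assms(4) by simp
    then show "x = y" using x y by (intro eq_vecI) (auto simp: e_def)
  qed
  have dist: "d \<le> mat_rank (X c - X c')" if c: "c \<in> Co" "c' \<in> Co" "c \<noteq> c'" for c c'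
  proof -
    \<comment> \<open>The difference of the two \<open>q\<close>-polynomials as an ordinary
      polynomial of degree at most \<open>q ^ k\<close>. For \<open>q > 1\<close> the exponents
      \<open>q ^ i\<close> are distinct, so a differing coefficient survives and \<open>P\<close> is
      nonzero; its roots then bound the kernel.\<close>
    define P where "P = (\<Sum>i\<le>k. monom (c i - c' i) (q ^ i))"
    have polyP: "poly P y = f c y - f c' y" for y
      by (simp add: P_def f_def poly_sum poly_monom left_diff_distrib sum_subtractf)
    obtain i where i: "i \<le> k" "c i \<noteq> c' i"
      using c unfolding Co_def by (metis PiE_ext atMost_iff)
    have "coeff P (q ^ i) = (\<Sum>j\<le>k. if j = i then c j - c' j else 0)"
      unfolding P_def coeff_sum using q1 by (intro sum.cong refl) auto
    then have "coeff P (q ^ i) \<noteq> 0" using i by simp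
    then have P0: "P \<noteq> 0" by auto
    have "degree P \<le> q ^ k"
      unfolding P_def
    proof (rule degree_sum_le)
      fix j assume "j \<in> {..k}"
      then have "q ^ j \<le> q ^ k" using q1 by (intro power_increasing) auto
      then show "degree (monom (c j - c' j) (q ^ j)) \<le> q ^ k"
        using degree_monom_le le_trans by blast
    qed simp
    then have roots: "card {y. poly P y = 0} \<le> q ^ k"
      using card_poly_roots_bound[OF P0] by linarith
    have D: "X c - X c' \<in> carrier_mat a b" using Xc[of c] Xc[of c'] by auto
    have "\<psi> ` mat_kernel (X c - X c') \<subseteq> {y. poly P y = 0}"
    proof safe
      fix x assume "x \<in> mat_kernel (X c - X c')"
      then have x: "x \<in> carrier_vec b" and 0: "(X c - X c') *\<^sub>v x = 0\<^sub>v a"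
        using mat_kernelD[OF D] by auto
      have "X c *\<^sub>v x - X c' *\<^sub>v x = 0\<^sub>v a"
        using 0 minus_mult_distrib_mat_vec[OF Xc Xc x] by simp
      then have "(X c *\<^sub>v x) $ i = (X c' *\<^sub>v x) $ i" if "i < a" for i
        using that Xc x by (metis (no_types, lifting) carrier_vecD eq_iff_diff_eq_0 index_minus_vec(1)
            index_zero_vec(1) mult_mat_vec_carrier)
      then have "f c (\<psi> x) = f c' (\<psi> x)"
        unfolding eval[OF c(1) x, symmetric] eval[OF c(2) x, symmetric] by simp
      then show "poly P (\<psi> x) = 0" by (simp add: polyP)
    qed
    moreover have "inj_on \<psi> (mat_kernel (X c - X c'))"
      using \<psi>_inj mat_kernel_carrier[OF D] inj_on_subset by blast
    ultimately have "card (mat_kernel (X c - X c')) \<le> card {y. poly P y = 0}"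
      using poly_roots_finite[OF P0] card_inj_on_le by blast
    then have "card (mat_kernel (X c - X c')) \<le> CARD('f) ^ k"
      using roots by (simp add: q_def)
    then show ?thesis
      using mat_rank_ge_of_card_kernel[OF D] assms(3) by (fastforce simp: k_def)
  qed
  have "inj_on X Co"
  proof (rule inj_onI, rule ccontr)
    fix c c' assume c: "c \<in> Co" "c' \<in> Co" "X c = X c'" "c \<noteq> c'"
    have "X c - X c' = 0\<^sub>m a b" unfolding c(3) using Xc[of c'] by (intro eq_matI) auto
    then have "mat_rank (X c - X c') = 0" by (simp add: mat_rank_zero)
    then show False using dist[OF c(1,2,4)] assms(2) by simp
  qed
  then have "card (X ` Co) = card Co" by (rule card_image)
  also have "\<dots> = CARD('f) ^ (a * (b - d + 1))"
    by (simp add: Co_def card_PiE card_ext_field[OF assms(1) a0] k_def power_add power_mult)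
  finally have "card (X ` Co) = CARD('f) ^ (a * (b - d + 1))" .
  moreover have "rank_metric_code a b d u (X ` Co)"
    unfolding rank_metric_code_def
    using Xc dist assms(5) mat_rank_le_dim_col[OF Xc] le_trans by blast
  ultimately show ?thesis by (metis card_le_Lambda)
qed

text \<open>When \<open>min a b \<le> u\<close> every matrix meets the rank bound, so
  \<open>u\<close> imposes nothing and the Singleton bound and the Gabidulin codes meet, with the
  larger side placed first.\<close>

lemma Lambda_eq_M_bound:
  assumes "primepow CARD('f::{finite,field})" "0 < d" "min a b \<le> u"
  shows "int (Lambda TYPE('f) a b d u) = M_bound CARD('f) a b d"
proof (cases "d \<le> min a b")
  case True
  have eq: "Lambda TYPE('f) a' b' d u = CARD('f) ^ (a' * (b' - d + 1))" if "b' \<le> a'" "b' \<le> u" "d \<le> b'" for a' b'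
    using Lambda_le_Singleton[where 'f = 'f, of d b' a' u] Lambda_ge_Gabidulin[OF assms(1), of d b' a' u] that assms
    by linarith
  have "Lambda TYPE('f) a b d u = Lambda TYPE('f) (max a b) (min a b) d u"
    using Lambda_commute[where 'f = 'f] by (cases "a \<le> b") (simp_all add: max_def min_def)
  also have "\<dots> = CARD('f) ^ (max a b * (min a b - d + 1))"
    using True assms by (intro eq) auto
  finally have "Lambda TYPE('f) a b d u = CARD('f) ^ (max a b * (min a b - d + 1))" .
  moreover have "int (max a b) * (int (min a b) - int d + 1) = int (max a b * (min a b - d + 1))"
    using True by (simp add: of_nat_diff distrib_left)
  ultimately show ?thesis
    unfolding M_bound_def by (simp only: power_int_of_nat) (simp flip: of_nat_power)
next
  case False
  \<comment> \<open>For \<open>d > min a b\<close> the exponent is at most 0, and exactly 0 at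
    \<open>d = min a b + 1\<close>. The power lies in (0, 1], its ceiling is 1, and this matches the
    trivial code.\<close>
  define e where "e = int (max a b) * (int (min a b) - int d + 1)"
  have "e \<le> 0" using False by (auto simp: e_def mult_nonneg_nonpos)
  moreover have "real CARD('f) > 1" using CARD_field_gt_1[where 'f = 'f] by simp
  ultimately have "real CARD('f) powi e \<le> 1" "real CARD('f) powi e > 0"
    by (auto simp: power_int_def inverse_le_1_iff intro!: power_le_one)
  then have "M_bound CARD('f) a b d = 1"
    unfolding M_bound_def e_def[symmetric] by (simp add: ceiling_eq_iff)
  then show ?thesis using Lambda_eq_1[where 'f = 'f, of u d a b] False by simp
qed

section \<open>Counting matrices of given rank\<close>

definition snoc_col :: "'f mat \<Rightarrow> 'f vec \<Rightarrow> 'f mat" where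
  "snoc_col X v = mat (dim_row X) (Suc (dim_col X)) (\<lambda>(i, j). if j < dim_col X then X $$ (i, j) else v $ i)"

lemma bij_betw_snoc_col:
  "bij_betw (\<lambda>(X, v). snoc_col X v) (carrier_mat a b \<times> carrier_vec a) (carrier_mat a (Suc b))"
proof (rule bij_betw_byWitness[where f' = "\<lambda>Z. (mat a b (\<lambda>ij. Z $$ ij), col Z b)"])
  show "\<forall>p\<in>carrier_mat a b \<times> carrier_vec a.
      (\<lambda>Z. (mat a b (\<lambda>ij. Z $$ ij), col Z b)) ((\<lambda>(X, v). snoc_col X v) p) = p"
    by (auto simp: snoc_col_def intro!: eq_matI eq_vecI)
  show "\<forall>Z\<in>carrier_mat a (Suc b). (\<lambda>(X, v). snoc_col X v) (mat a b (\<lambda>ij. Z $$ ij), col Z b) = Z"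
    by (auto simp: snoc_col_def less_Suc_eq intro!: eq_matI)
qed (auto simp: snoc_col_def)

lemma mat_image_snoc_col:
  fixes X :: "'f::field mat"
  assumes X: "X \<in> carrier_mat a b" and v: "v \<in> carrier_vec a"
  shows "mat_image (snoc_col X v) = (\<lambda>(t, y). y + t \<cdot>\<^sub>v v) ` (UNIV \<times> mat_image X)"
proof -
  have Z: "snoc_col X v \<in> carrier_mat a (Suc b)" using X by (auto simp: snoc_col_def)
  have mult: "snoc_col X v *\<^sub>v z = X *\<^sub>v vec b (\<lambda>j. z $ j) + (z $ b) \<cdot>\<^sub>v v"
    if "z \<in> carrier_vec (Suc b)" for z
    using X v that
    by (intro eq_vecI) (auto simp: snoc_col_def scalar_prod_def mult.commute)
  have "y + t \<cdot>\<^sub>v v \<in> mat_image (snoc_col X v)" if y: "y \<in> mat_image X" for y t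
  proof -
    obtain x where x: "x \<in> carrier_vec b" "y = X *\<^sub>v x" using y X by (auto simp: mat_image_def)
    define z where "z = vec (Suc b) (\<lambda>j. if j < b then x $ j else t)"
    have "vec b (\<lambda>j. z $ j) = x" "z $ b = t" using x by (auto simp: z_def intro!: eq_vecI)
    moreover have "z \<in> carrier_vec (Suc b)" by (simp add: z_def)
    ultimately have "y + t \<cdot>\<^sub>v v = snoc_col X v *\<^sub>v z" by (simp add: mult x)
    then show ?thesis using \<open>z \<in> carrier_vec (Suc b)\<close> Z by (auto simp: mat_image_def)
  qed
  moreover have "snoc_col X v *\<^sub>v z \<in> (\<lambda>(t, y). y + t \<cdot>\<^sub>v v) ` (UNIV \<times> mat_image X)"
    if "z \<in> carrier_vec (Suc b)" for z
    using X that by (auto simp: mult mat_image_def intro!: image_eqI[where x = "(z $ b, X *\<^sub>v vec b (\<lambda>j. z $ j))"])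
  ultimately show ?thesis using Z by (auto simp: mat_image_def[of "snoc_col X v"])
qed

lemma mat_image_closed:
  assumes X: "X \<in> carrier_mat a b" and x: "x \<in> mat_image X" and y: "y \<in> mat_image X"
  shows "x + y \<in> mat_image X" and "x - y \<in> mat_image X" and "t \<cdot>\<^sub>v x \<in> mat_image X"
proof -
  obtain x' y' where x': "x' \<in> carrier_vec b" "x = X *\<^sub>v x'" and y': "y' \<in> carrier_vec b" "y = X *\<^sub>v y'"
    using x y X by (auto simp: mat_image_def)
  have "x + y = X *\<^sub>v (x' + y')" "x - y = X *\<^sub>v (x' - y')" "t \<cdot>\<^sub>v x = X *\<^sub>v (t \<cdot>\<^sub>v x')"
    using X x' y' by (auto simp: mult_add_distrib_mat_vec mult_minus_distrib_mat_vec mult_mat_vec)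
  then show "x + y \<in> mat_image X" "x - y \<in> mat_image X" "t \<cdot>\<^sub>v x \<in> mat_image X"
    using X x' y' by (auto simp: mat_image_def)
qed

text \<open>A column outside the image makes (t, y) \<mapsto> y + t v injective, since from two
  representations with different \<open>t\<close> one could solve for \<open>v\<close> inside the
  image. The image then grows by the factor \<open>q\<close>.\<close>

lemma mat_rank_snoc_col:
  fixes X :: "'f::{finite,field} mat"
  assumes X: "X \<in> carrier_mat a b" and v: "v \<in> carrier_vec a"
  shows "mat_rank (snoc_col X v) = (if v \<in> mat_image X then mat_rank X else Suc (mat_rank X))"
proof (cases "v \<in> mat_image X")
  case True
  have "mat_image (snoc_col X v) = mat_image X"
  proof
    show "mat_image (snoc_col X v) \<subseteq> mat_image X"
      unfolding mat_image_snoc_col[OF X v] using True mat_image_closed[OF X] by auto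
    have "y = y + 0 \<cdot>\<^sub>v v" if "y \<in> mat_image X" for y
      using that mat_image_subset[OF X] v by (intro eq_vecI) auto
    then show "mat_image X \<subseteq> mat_image (snoc_col X v)"
      unfolding mat_image_snoc_col[OF X v] by (force simp: image_iff)
  qed
  then have "mat_rank (snoc_col X v) = mat_rank X" by (intro mat_rank_eqI) (simp only: card_mat_image)
  then show ?thesis using True by simp
next
  case False
  have "inj_on (\<lambda>(t, y). y + t \<cdot>\<^sub>v v) (UNIV \<times> mat_image X)"
  proof (rule inj_onI, clarify)
    fix t t' y y' assume y: "y \<in> mat_image X" "y' \<in> mat_image X" and eq: "y + t \<cdot>\<^sub>v v = y' + t' \<cdot>\<^sub>v v"
    have yc: "y \<in> carrier_vec a" "y' \<in> carrier_vec a" using y mat_image_subset[OF X] by auto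
    have comp: "y $ i + t * v $ i = y' $ i + t' * v $ i" if "i < a" for i
      using arg_cong[OF eq, of "\<lambda>w. w $ i"] that yc v by simp
    have "t = t'"
    proof (rule ccontr)
      assume ne: "t \<noteq> t'"
      have "v = (1 / (t - t')) \<cdot>\<^sub>v (y' - y)"
      proof (rule eq_vecI)
        fix i assume "i < dim_vec ((1 / (t - t')) \<cdot>\<^sub>v (y' - y))"
        then have i: "i < a" using yc by simp
        have "(t - t') * v $ i = y' $ i - y $ i" using comp[OF i] by (simp add: algebra_simps)
        then have "v $ i = (y' $ i - y $ i) / (t - t')" using ne by (simp add: nonzero_eq_divide_eq mult.commute)
        then show "v $ i = ((1 / (t - t')) \<cdot>\<^sub>v (y' - y)) $ i" using i yc by simp
      qed (use v yc in auto)
      moreover have "(1 / (t - t')) \<cdot>\<^sub>v (y' - y) \<in> mat_image X"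
        using y mat_image_closed[OF X] by blast
      ultimately show False using False by simp
    qed
    moreover have "y = y'" using comp \<open>t = t'\<close> yc by (intro eq_vecI) auto
    ultimately show "t = t' \<and> y = y'" by simp
  qed
  then have "card (mat_image (snoc_col X v)) = CARD('f) ^ Suc (mat_rank X)"
    unfolding mat_image_snoc_col[OF X v] by (simp add: card_image card_cartesian_product card_mat_image)
  then have "mat_rank (snoc_col X v) = Suc (mat_rank X)" by (rule mat_rank_eqI)
  then show ?thesis using False by simp
qed

section \<open>Recursion for the number of matrices of given rank\<close>

definition rank_mats :: "nat \<Rightarrow> nat \<Rightarrow> nat \<Rightarrow> 'f::field mat set" where
  "rank_mats a b r = {X \<in> carrier_mat a b. mat_rank X = r}"

lemma finite_rank_mats: "finite (rank_mats a b r :: 'f::{finite,field} mat set)"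
  unfolding rank_mats_def by (rule finite_subset[OF _ finite_carrier_mat_finite[of a b]]) auto

lemma card_rank_mats_0: "card (rank_mats a b 0 :: 'f::{finite,field} mat set) = 1"
proof -
  have "rank_mats a b 0 = {0\<^sub>m a b :: 'f mat}"
    unfolding rank_mats_def using mat_rank_eq_0_iff[where 'f = 'f] by (auto simp: mat_rank_zero)
  then show ?thesis by simp
qed

text \<open>Rank \<open>r + 1\<close> arises by appending to a matrix of rank \<open>r + 1\<close>
  one of the q^(r+1) columns in its image (the set \<open>S\<close>), or to a matrix of rank
  \<open>r\<close> one of the q^a - q^r columns outside its image (the set
  \<open>T\<close>).\<close>

lemma card_rank_mats_Suc:
  "real (card (rank_mats a (Suc b) (Suc r) :: 'f::{finite,field} mat set)) =
    real CARD('f) ^ Suc r * real (card (rank_mats a b (Suc r) :: 'f mat set)) +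
    (real CARD('f) ^ a - real CARD('f) ^ r) * real (card (rank_mats a b r :: 'f mat set))"
proof -
  define S where "S = Sigma (rank_mats a b (Suc r)) (mat_image :: 'f mat \<Rightarrow> 'f vec set)"
  define T where "T = Sigma (rank_mats a b r) (\<lambda>X. carrier_vec a - mat_image X :: 'f vec set)"
  have sub: "S \<union> T \<subseteq> carrier_mat a b \<times> carrier_vec a"
    unfolding S_def T_def rank_mats_def by safe (erule (1) subsetD[OF mat_image_subset])
  have "(\<lambda>(X, v). snoc_col X v) ` (S \<union> T) = rank_mats a (Suc b) (Suc r)"
  proof (intro equalityI subsetI)
    fix Z :: "'f mat" assume "Z \<in> (\<lambda>(X, v). snoc_col X v) ` (S \<union> T)"
    then obtain X v where Xv: "(X, v) \<in> S \<union> T" "Z = snoc_col X v" by auto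
    then have "X \<in> carrier_mat a b" "v \<in> carrier_vec a" using sub by auto
    moreover from this have "Z \<in> carrier_mat a (Suc b)" using Xv(2) by (auto simp: snoc_col_def)
    ultimately show "Z \<in> rank_mats a (Suc b) (Suc r)"
      using Xv mat_rank_snoc_col[of X a b v] by (auto simp: rank_mats_def S_def T_def)
  next
    fix Z :: "'f mat" assume Z: "Z \<in> rank_mats a (Suc b) (Suc r)"
    then have "Z \<in> (\<lambda>(X, v). snoc_col X v) ` (carrier_mat a b \<times> carrier_vec a)"
      using bij_betw_snoc_col[of a b] by (auto simp: bij_betw_def rank_mats_def)
    then obtain X v where Xv: "X \<in> carrier_mat a b" "v \<in> carrier_vec a" "Z = snoc_col X v" by auto
    then have "(X, v) \<in> S \<union> T"
      using Z mat_rank_snoc_col[OF Xv(1,2)] by (auto simp: rank_mats_def S_def T_def split: if_splits)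
    then show "Z \<in> (\<lambda>(X, v). snoc_col X v) ` (S \<union> T)" using Xv(3) by force
  qed
  moreover have "inj_on (\<lambda>(X, v). snoc_col X v) (S \<union> T)"
    using bij_betw_snoc_col[of a b] sub inj_on_subset unfolding bij_betw_def by blast
  ultimately have "card (rank_mats a (Suc b) (Suc r) :: 'f mat set) = card (S \<union> T)"
    by (metis card_image)
  also have "\<dots> = card S + card T"
  proof (rule card_Un_disjoint)
    show "finite S" "finite T"
      unfolding S_def T_def
      by (intro finite_SigmaI finite_Diff finite_rank_mats finite_mat_image finite_carrier_vec_finite)+
    show "S \<inter> T = {}" by (auto simp: S_def T_def)
  qed
  also have "card S = CARD('f) ^ Suc r * card (rank_mats a b (Suc r) :: 'f mat set)"
  proof -
    have "card S = (\<Sum>X\<in>(rank_mats a b (Suc r) :: 'f mat set). card (mat_image X))"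
      unfolding S_def by (intro card_SigmaI finite_rank_mats ballI finite_mat_image)
    also have "\<dots> = (\<Sum>X\<in>(rank_mats a b (Suc r) :: 'f mat set). CARD('f) ^ Suc r)"
      by (intro sum.cong refl) (simp add: card_mat_image rank_mats_def)
    finally show ?thesis by simp
  qed
  finally have *: "card (rank_mats a (Suc b) (Suc r) :: 'f mat set) =
      CARD('f) ^ Suc r * card (rank_mats a b (Suc r) :: 'f mat set) + card T" .
  have "card T = (\<Sum>X\<in>(rank_mats a b r :: 'f mat set). card (carrier_vec a - mat_image X))"
    unfolding T_def
    by (intro card_SigmaI finite_rank_mats ballI finite_Diff finite_carrier_vec_finite)
  also have "real \<dots> = (\<Sum>X\<in>(rank_mats a b r :: 'f mat set). real CARD('f) ^ a - real CARD('f) ^ r)"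
    unfolding of_nat_sum
  proof (rule sum.cong[OF refl])
    fix X :: "'f mat" assume "X \<in> rank_mats a b r"
    then have sub: "mat_image X \<subseteq> carrier_vec a" and r: "mat_rank X = r"
      using mat_image_subset by (auto simp: rank_mats_def)
    have "card (mat_image X) \<le> card (carrier_vec a :: 'f vec set)"
      using sub by (intro card_mono finite_carrier_vec_finite)
    then show "real (card (carrier_vec a - mat_image X)) = real CARD('f) ^ a - real CARD('f) ^ r"
      using sub r by (simp add: card_Diff_subset finite_mat_image of_nat_diff card_carrier_vec card_mat_image)
  qed
  finally have "real (card T) = (real CARD('f) ^ a - real CARD('f) ^ r) * real (card (rank_mats a b r :: 'f mat set))"
    by simp
  then show ?thesis unfolding * by simp
qed

text \<open>The \<open>q\<close>-analogue of the falling factorial. At a prime power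
  \<open>q\<close> it counts the \<open>r\<close>-tuples of linearly independent vectors in a space
  of dimension \<open>n\<close>.\<close>

definition q_falling :: "real \<Rightarrow> nat \<Rightarrow> nat \<Rightarrow> real" where
  "q_falling q n r = (\<Prod>i<r. q ^ n - q ^ i)"

lemma q_falling_Suc: "q_falling q n (Suc r) = q_falling q n r * (q ^ n - q ^ r)"
  by (simp add: q_falling_def)

text \<open>The factor for \<open>i = 0\<close> is split off, and one \<open>q\<close> is taken out
  of each of the other \<open>r\<close> factors.\<close>

lemma q_falling_Suc_Suc: "q_falling q (Suc n) (Suc r) = (q ^ Suc n - 1) * q ^ r * q_falling q n r"
proof -
  have "q_falling q (Suc n) (Suc r) = (q ^ Suc n - 1) * (\<Prod>i<r. q ^ Suc n - q ^ Suc i)"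
    unfolding q_falling_def by (subst prod.lessThan_Suc_shift) simp
  also have "(\<Prod>i<r. q ^ Suc n - q ^ Suc i) = (\<Prod>i<r. q * (q ^ n - q ^ i))"
    by (simp add: right_diff_distrib)
  finally show ?thesis by (simp add: prod.distrib q_falling_def)
qed

lemma q_falling_self_nonzero: "q > 1 \<Longrightarrow> q_falling q r r \<noteq> 0"
  by (simp add: q_falling_def)

lemma q_binomial_eq: "q_binomial q n r = q_falling (real q) n r / q_falling (real q) r r"
  by (simp add: q_binomial_def q_falling_def prod_dividef)

text \<open>Over a common denominator this is the splitting of Q^(n+1) - 1 into Q^(n+1) - Q^(r+1)
  and Q^(r+1) - 1.\<close>

lemma q_binomial_Pascal:
  assumes "q > 1"
  shows "q_binomial q (Suc n) (Suc r) = real q ^ Suc r * q_binomial q n (Suc r) + q_binomial q n r"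
proof -
  define Q where "Q = real q"
  have Q: "Q > 1" using assms by (simp add: Q_def)
  define D P where "D = q_falling Q r r" and "P = q_falling Q n r"
  have "Q ^ Suc r > 1" using Q by (intro one_less_power) auto
  then have c: "(Q ^ Suc r - 1) * Q ^ r \<noteq> 0" using Q by simp
  have split: "(N * R + e * P) / (e * D) = R * (N / (e * D)) + P / D" if "e \<noteq> 0" for N R e :: real
    using that by (simp add: add_divide_distrib)
  have "(Q ^ Suc n - 1) * Q ^ r * P = P * (Q ^ n - Q ^ r) * Q ^ Suc r + (Q ^ Suc r - 1) * Q ^ r * P"
    by (simp add: algebra_simps)
  then have "(Q ^ Suc n - 1) * Q ^ r * P / ((Q ^ Suc r - 1) * Q ^ r * D)
      = Q ^ Suc r * (P * (Q ^ n - Q ^ r) / ((Q ^ Suc r - 1) * Q ^ r * D)) + P / D"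
    using split[OF c] by simp
  then show ?thesis
    unfolding q_binomial_eq Q_def[symmetric] q_falling_Suc_Suc D_def[symmetric] P_def[symmetric]
      q_falling_Suc[of Q n r] .
qed

text \<open>At a prime power \<open>q\<close> this is the order of the general linear group of
  degree \<open>r\<close>. Each step contributes (q - 1) [r+1]_q and q^r, and the exponents of
  \<open>q\<close> add up to the binomial coefficient.\<close>

lemma q_falling_self_eq:
  assumes "q > 1"
  shows "q_falling (real q) r r = real q ^ (r choose 2) * (real q - 1) ^ r * q_fact q r"
proof (induction r)
  case 0
  then show ?case by (simp add: q_falling_def q_fact_def binomial_eq_0)
next
  case (Suc r)
  have "q_fact q (Suc r) = q_fact q r * ((real q ^ Suc r - 1) / (real q - 1))"
    by (simp add: q_fact_def q_int_def)
  moreover have "Suc r choose 2 = r + (r choose 2)"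
    by (simp add: numeral_2_eq_2)
  ultimately show ?case
    using assms by (simp add: q_falling_Suc_Suc Suc power_add del: power_Suc)
qed

text \<open>Both sides satisfy the recursion of \<open>card_rank_mats_Suc\<close>. The product reads
  as a choice of the row space, \<open>q_binomial\<close> in number, followed by an injective linear
  map into the space of columns.\<close>

lemma card_rank_mats:
  "real (card (rank_mats a b r :: 'f::{finite,field} mat set))
    = q_falling (real CARD('f)) a r * q_binomial CARD('f) b r"
proof (induction b arbitrary: r)
  case 0
  show ?case
  proof (cases r)
    case 0
    then show ?thesis by (simp add: card_rank_mats_0 q_falling_def q_binomial_def)
  next
    case (Suc s)
    have "rank_mats a 0 r = ({} :: 'f mat set)"
      using mat_rank_le_dim_col[where 'f = 'f and a = a and b = 0] Suc by (fastforce simp: rank_mats_def)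
    \<comment> \<open>For \<open>r > 0\<close> the factor with \<open>i = 0\<close> is q^0 -
      q^0.\<close>
    moreover have "q_binomial CARD('f) 0 r = 0"
      by (simp add: q_binomial_def Suc prod.lessThan_Suc_shift del: prod.lessThan_Suc)
    ultimately show ?thesis by simp
  qed
next
  case (Suc b)
  show ?case
  proof (cases r)
    case 0
    then show ?thesis by (simp add: card_rank_mats_0 q_falling_def q_binomial_def)
  next
    case (Suc s)
    show ?thesis
      unfolding Suc card_rank_mats_Suc q_binomial_Pascal[OF CARD_field_gt_1] Suc.IH q_falling_Suc
      by (simp add: algebra_simps)
  qed
qed

lemma Lambda_distance_1:
  "real (Lambda TYPE('f::{finite,field}) a b 1 u) =
     (\<Sum>r=0..min u (min a b). real CARD('f) ^ (r choose 2) * (real CARD('f) - 1) ^ r * q_fact CARD('f) r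
        * q_binomial CARD('f) a r * q_binomial CARD('f) b r)"
proof -
  define S where "S = {X :: 'f mat. X \<in> carrier_mat a b \<and> mat_rank X \<le> u}"
  have finS: "finite S" unfolding S_def by (rule finite_subset[OF _ finite_carrier_mat_finite[of a b]]) auto
  have "1 \<le> mat_rank (X - Y)" if X: "X \<in> carrier_mat a b" and Y: "Y \<in> carrier_mat a b" and ne: "X \<noteq> Y" for X Y :: "'f mat"
  proof (rule ccontr)
    assume "\<not> 1 \<le> mat_rank (X - Y)"
    moreover have "X - Y \<in> carrier_mat a b" using Y by (rule minus_carrier_mat)
    ultimately have eq: "X - Y = 0\<^sub>m a b" using mat_rank_eq_0_iff[of "X - Y" a b] by simp
    have "X = Y"
    proof (rule eq_matI)
      fix i j assume "i < dim_row Y" "j < dim_col Y"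
      then show "X $$ (i, j) = Y $$ (i, j)"
        using arg_cong[OF eq, of "\<lambda>Z. Z $$ (i, j)"] X Y by simp
    qed (use X Y in auto)
    then show False using ne by simp
  qed
  then have "rank_metric_code a b 1 u S" by (auto simp: rank_metric_code_def S_def)
  then have "card S \<le> Lambda TYPE('f) a b 1 u" by (rule card_le_Lambda)
  moreover have "Lambda TYPE('f) a b 1 u \<le> card S"
  proof -
    obtain C :: "'f mat set" where C: "rank_metric_code a b 1 u C" "card C = Lambda TYPE('f) a b 1 u"
      by (rule Lambda_attained)
    then have "C \<subseteq> S" by (auto simp: rank_metric_code_def S_def)
    then show ?thesis using C(2) card_mono[OF finS] by metis
  qed
  ultimately have L: "Lambda TYPE('f) a b 1 u = card S" by simp
  have "S = (\<Union>r\<in>{0..min u (min a b)}. rank_mats a b r)"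
    using mat_rank_le_dim_col[where 'f = 'f and a = a and b = b]
      mat_rank_le_dim_row[where 'f = 'f and a = a and b = b]
    by (auto simp: S_def rank_mats_def)
  then have "card S = (\<Sum>r=0..min u (min a b). card (rank_mats a b r :: 'f mat set))"
    by (simp only:) (subst card_UN_disjoint, auto simp: finite_rank_mats, auto simp: rank_mats_def)
  then have "real (card S) = (\<Sum>r=0..min u (min a b). q_falling (real CARD('f)) a r * q_binomial CARD('f) b r)"
    by (simp add: card_rank_mats)
  also have "\<dots> = (\<Sum>r=0..min u (min a b). real CARD('f) ^ (r choose 2) * (real CARD('f) - 1) ^ r * q_fact CARD('f) r
        * q_binomial CARD('f) a r * q_binomial CARD('f) b r)"
  proof (rule sum.cong[OF refl])
    fix r
    have "real CARD('f) > 1" using CARD_field_gt_1[where 'f = 'f] by simp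
    \<comment> \<open>Dividing out \<open>q_falling\<close> at \<open>r\<close> makes the count
      symmetric in \<open>a\<close> and \<open>b\<close>, and the quotient supplies the second
      Gaussian binomial.\<close>
    then have "q_falling (real CARD('f)) a r = q_falling (real CARD('f)) r r * q_binomial CARD('f) a r"
      using q_falling_self_nonzero[of "real CARD('f)" r] by (simp add: q_binomial_eq)
    then show "q_falling (real CARD('f)) a r * q_binomial CARD('f) b r =
        real CARD('f) ^ (r choose 2) * (real CARD('f) - 1) ^ r * q_fact CARD('f) r
        * q_binomial CARD('f) a r * q_binomial CARD('f) b r"
      by (simp add: q_falling_self_eq[OF CARD_field_gt_1])
  qed
  finally show ?thesis using L by simp
qed

section \<open>Constant-dimension codes\<close>

lemma inj_on_mult_mat_vecD:
  fixes P :: "'f::field mat"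
  assumes "inj_on ((*\<^sub>v) P) (carrier_vec k)" and P: "P \<in> carrier_mat a k"
    and "x \<in> carrier_vec k" "P *\<^sub>v x = 0\<^sub>v a"
  shows "x = 0\<^sub>v k"
proof (rule inj_onD[OF assms(1)])
  have "P *\<^sub>v 0\<^sub>v k = 0\<^sub>v a" using P by (intro eq_vecI) auto
  then show "P *\<^sub>v x = P *\<^sub>v 0\<^sub>v k" using assms(4) by simp
qed (use assms in auto)

lemma mat_rank_of_inj:
  fixes P :: "'f::{finite,field} mat"
  assumes "P \<in> carrier_mat a k" "inj_on ((*\<^sub>v) P) (carrier_vec k)"
  shows "mat_rank P = k"
  using assms by (intro mat_rank_eqI) (auto simp: mat_image_def card_image card_carrier_vec)

lemma mat_rank_mult_of_inj:
  fixes P :: "'f::{finite,field} mat"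
  assumes P: "P \<in> carrier_mat a k" and inj: "inj_on ((*\<^sub>v) P) (carrier_vec k)" and Q: "Q \<in> carrier_mat k b"
  shows "mat_rank (P * Q) = mat_rank Q"
proof (rule mat_rank_eqI)
  have "mat_image (P * Q) = (*\<^sub>v) P ` mat_image Q"
    using P Q by (auto simp: mat_image_def image_image)
  moreover have "inj_on ((*\<^sub>v) P) (mat_image Q)"
    using inj mat_image_subset[OF Q] inj_on_subset by blast
  ultimately show "card (mat_image (P * Q)) = CARD('f) ^ mat_rank Q"
    by (metis card_image card_mat_image)
qed

text \<open>The block matrix [P | c R]. The scalar absorbs the sign of a difference:
  \<open>c = 1\<close> is used for the left factor and \<open>c = -1\<close> for the right
  one.\<close>

definition hcat :: "'f::field \<Rightarrow> 'f mat \<Rightarrow> 'f mat \<Rightarrow> 'f mat" where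
  "hcat c P R = mat (dim_row P) (dim_col P + dim_col R)
     (\<lambda>(i, j). if j < dim_col P then P $$ (i, j) else c * R $$ (i, j - dim_col P))"

lemma hcat_carrier [simp]:
  "P \<in> carrier_mat m k \<Longrightarrow> R \<in> carrier_mat m l \<Longrightarrow> hcat c P R \<in> carrier_mat m (k + l)"
  by (auto simp: hcat_def)

lemma sum_split_add: "(\<Sum>j = 0..<k + l. f j) = (\<Sum>j = 0..<k. f j) + (\<Sum>j = 0..<l. f (k + j))"
  for f :: "nat \<Rightarrow> 'a::comm_monoid_add"
  using sum.atLeastLessThan_concat[of 0 k "k + l" f] sum.shift_bounds_nat_ivl[of f 0 k l]
  by (simp add: add.commute)

lemma hcat_mult_vec:
  assumes P: "P \<in> carrier_mat m k" and R: "R \<in> carrier_mat m l"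
    and y: "y \<in> carrier_vec k" and z: "z \<in> carrier_vec l"
  shows "hcat c P R *\<^sub>v (y @\<^sub>v z) = P *\<^sub>v y + R *\<^sub>v (c \<cdot>\<^sub>v z)"
proof (rule eq_vecI)
  fix i assume "i < dim_vec (P *\<^sub>v y + R *\<^sub>v (c \<cdot>\<^sub>v z))"
  then have i: "i < m" using R by simp
  have "(hcat c P R *\<^sub>v (y @\<^sub>v z)) $ i = (\<Sum>j = 0..<k + l. hcat c P R $$ (i, j) * (y @\<^sub>v z) $ j)"
    using P R y z i by (simp add: scalar_prod_def hcat_def)
  also have "\<dots> = (\<Sum>j = 0..<k. P $$ (i, j) * y $ j) + (\<Sum>j = 0..<l. R $$ (i, j) * (c * z $ j))"
    unfolding sum_split_add using P R y z i by (intro arg_cong2[where f = "(+)"] sum.cong) (auto simp: hcat_def)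
  also have "\<dots> = (P *\<^sub>v y + R *\<^sub>v (c \<cdot>\<^sub>v z)) $ i"
    using P R y z i by (simp add: scalar_prod_def)
  finally show "(hcat c P R *\<^sub>v (y @\<^sub>v z)) $ i = (P *\<^sub>v y + R *\<^sub>v (c \<cdot>\<^sub>v z)) $ i" .
qed (use P R in \<open>auto simp: hcat_def\<close>)

text \<open>A kernel vector splits into \<open>y\<close> and \<open>z\<close> whose images under
  \<open>P\<close> and under \<open>- c\<close> times \<open>R\<close> agree. The common value lies
  in both images, hence is zero, and injectivity of each block finishes.\<close>

lemma inj_on_hcat:
  assumes P: "P \<in> carrier_mat m k" and R: "R \<in> carrier_mat m l"
    and injP: "inj_on ((*\<^sub>v) P) (carrier_vec k)" and injR: "inj_on ((*\<^sub>v) R) (carrier_vec l)"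
    and disj: "mat_image P \<inter> mat_image R \<subseteq> {0\<^sub>v m}" and c: "c \<noteq> 0"
  shows "inj_on ((*\<^sub>v) (hcat c P R)) (carrier_vec (k + l))"
proof (rule inj_on_mult_mat_vecI)
  show "hcat c P R \<in> carrier_mat m (k + l)" using P R by simp
  fix x :: "'a vec" assume x: "x \<in> carrier_vec (k + l)" and 0: "hcat c P R *\<^sub>v x = 0\<^sub>v m"
  define y z where "y = vec_first x k" and "z = vec_last x l"
  have y: "y \<in> carrier_vec k" and z: "z \<in> carrier_vec l" by (simp_all add: y_def z_def)
  have xyz: "x = y @\<^sub>v z" using vec_first_last_append[OF x] by (simp add: y_def z_def)
  have sum0: "P *\<^sub>v y + R *\<^sub>v (c \<cdot>\<^sub>v z) = 0\<^sub>v m"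
    using 0 hcat_mult_vec[OF P R y z] xyz by simp
  have "P *\<^sub>v y = R *\<^sub>v (- c \<cdot>\<^sub>v z)"
  proof (rule eq_vecI)
    fix i assume "i < dim_vec (R *\<^sub>v (- c \<cdot>\<^sub>v z))"
    then have i: "i < m" using R by simp
    have "(P *\<^sub>v y) $ i + (R *\<^sub>v (c \<cdot>\<^sub>v z)) $ i = 0"
      using arg_cong[OF sum0, of "\<lambda>v. v $ i"] i P R by simp
    moreover have "(R *\<^sub>v (- c \<cdot>\<^sub>v z)) $ i = - (R *\<^sub>v (c \<cdot>\<^sub>v z)) $ i"
      using i R z by (simp add: scalar_prod_def sum_negf)
    ultimately show "(P *\<^sub>v y) $ i = (R *\<^sub>v (- c \<cdot>\<^sub>v z)) $ i" by (metis eq_neg_iff_add_eq_0)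
  qed (use P R in auto)
  moreover have "P *\<^sub>v y \<in> mat_image P" "R *\<^sub>v (- c \<cdot>\<^sub>v z) \<in> mat_image R"
    using P R y z by (auto simp: mat_image_def)
  ultimately have Py: "P *\<^sub>v y = 0\<^sub>v m" and Rz: "R *\<^sub>v (- c \<cdot>\<^sub>v z) = 0\<^sub>v m"
    using disj by auto
  have y0: "y = 0\<^sub>v k" using inj_on_mult_mat_vecD[OF injP P y Py] .
  have cz: "- c \<cdot>\<^sub>v z = 0\<^sub>v l" using z by (intro inj_on_mult_mat_vecD[OF injR R _ Rz]) simp
  have "z $ i = 0" if "i < l" for i
    using arg_cong[OF cz, of "\<lambda>v. v $ i"] that z c by simp
  then have z0: "z = 0\<^sub>v l" using z by (intro eq_vecI) auto
  show "x = 0\<^sub>v (k + l)" unfolding xyz y0 z0 by (intro eq_vecI) auto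
qed

text \<open>The difference equals \<open>A * B\<^sup>T\<close> for block matrices with independent
  columns. The injective \<open>A\<close> preserves the rank of \<open>B\<^sup>T\<close>, which is
  the full number \<open>k + l\<close> of columns of \<open>B\<close>.\<close>

lemma mat_rank_diff_of_disjoint:
  fixes P :: "'f::{finite,field} mat"
  assumes P: "P \<in> carrier_mat m k" and R: "R \<in> carrier_mat m l"
    and S: "S \<in> carrier_mat n k" and T: "T \<in> carrier_mat n l"
    and inj: "inj_on ((*\<^sub>v) P) (carrier_vec k)" "inj_on ((*\<^sub>v) R) (carrier_vec l)"
      "inj_on ((*\<^sub>v) S) (carrier_vec k)" "inj_on ((*\<^sub>v) T) (carrier_vec l)"
    and disj: "mat_image P \<inter> mat_image R \<subseteq> {0\<^sub>v m}" "mat_image S \<inter> mat_image T \<subseteq> {0\<^sub>v n}"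
  shows "mat_rank (P * S\<^sup>T - R * T\<^sup>T) = k + l"
proof -
  define A B where "A = hcat 1 P R" and "B = hcat (-1) S T"
  have A: "A \<in> carrier_mat m (k + l)" and B: "B \<in> carrier_mat n (k + l)"
    using P R S T by (simp_all add: A_def B_def)
  have "P * S\<^sup>T - R * T\<^sup>T = A * B\<^sup>T"
  proof (rule eq_matI)
    fix i j assume "i < dim_row (A * B\<^sup>T)" "j < dim_col (A * B\<^sup>T)"
    then have i: "i < m" and j: "j < n" using A B by auto
    have "(A * B\<^sup>T) $$ (i, j) = (\<Sum>t = 0..<k + l. A $$ (i, t) * B $$ (j, t))"
      using A B i j by (simp add: scalar_prod_def)
    also have "\<dots> = (\<Sum>t = 0..<k. P $$ (i, t) * S $$ (j, t)) + (\<Sum>t = 0..<l. - (R $$ (i, t) * T $$ (j, t)))"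
      unfolding sum_split_add using P R S T i j
      by (intro arg_cong2[where f = "(+)"] sum.cong) (auto simp: A_def B_def hcat_def)
    also have "\<dots> = (P * S\<^sup>T - R * T\<^sup>T) $$ (i, j)"
      using P R S T i j by (simp add: scalar_prod_def sum_negf)
    finally show "(P * S\<^sup>T - R * T\<^sup>T) $$ (i, j) = (A * B\<^sup>T) $$ (i, j)" by simp
  qed (use P R S T A B in auto)
  also have "mat_rank (A * B\<^sup>T) = mat_rank B\<^sup>T"
    unfolding A_def using B P R inj disj
    by (intro mat_rank_mult_of_inj[of _ m "k + l"] inj_on_hcat) auto
  also have "\<dots> = k + l"
    unfolding mat_rank_transpose B_def using S T inj disj
    by (intro mat_rank_of_inj[of _ n] inj_on_hcat hcat_carrier) auto
  finally show ?thesis .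
qed

definition pad_mat :: "nat \<Rightarrow> nat \<Rightarrow> 'f::field mat" where
  "pad_mat n m = mat n m (\<lambda>(i, j). if i = j then 1 else 0)"

lemma pad_mat_carrier [simp]: "pad_mat n m \<in> carrier_mat n m"
  by (simp add: pad_mat_def)

lemma inj_on_pad_mat:
  assumes "m \<le> n"
  shows "inj_on ((*\<^sub>v) (pad_mat n m :: 'f::field mat)) (carrier_vec m)"
proof (rule inj_on_mult_mat_vecI[OF pad_mat_carrier])
  fix x :: "'f vec" assume x: "x \<in> carrier_vec m" and 0: "pad_mat n m *\<^sub>v x = 0\<^sub>v n"
  have "x $ i = 0" if i: "i < m" for i
  proof -
    have "(pad_mat n m *\<^sub>v x) $ i = (\<Sum>j = 0..<m. (if i = j then 1 else 0) * x $ j)"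
      using i x assms by (simp add: pad_mat_def scalar_prod_def)
    also have "\<dots> = (\<Sum>j = 0..<m. if i = j then x $ j else 0)" by (intro sum.cong) auto
    also have "\<dots> = x $ i" using i by simp
    finally show ?thesis using 0 i assms by simp
  qed
  then show "x = 0\<^sub>v m" using x by (intro eq_vecI) auto
qed

section \<open>Subspaces as column spaces, and the dimension formula\<close>

lemma subspace_eq_mat_image:
  fixes U :: "'f::{finite,field} vec set"
  assumes "VectorSpace.subspace class_ring U (module_vec TYPE('f) n)"
  obtains P where "P \<in> carrier_mat n (subspace_dim n U)"
    "inj_on ((*\<^sub>v) P) (carrier_vec (subspace_dim n U))" "mat_image P = U"
proof -
  obtain P where P: "P \<in> carrier_mat n (subspace_dim n U)"
    "bij_betw ((*\<^sub>v) P) (carrier_vec (subspace_dim n U)) U"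
    using subspace_basis_matrix[OF assms] by blast
  have "mat_image P = U"
    unfolding mat_image_def carrier_matD(2)[OF P(1)] using P(2) by (rule bij_betw_imp_surj_on)
  then show ?thesis using that[OF P(1) bij_betw_imp_inj_on[OF P(2)]] by blast
qed

lemma submodule_sum_vec:
  "module.submodule_sum (module_vec TYPE('f::field) n) U W = (\<lambda>(x, y). x + y) ` (U \<times> W)"
  unfolding module.submodule_sum_def[OF vec_module] by (auto simp: module_vec_simps)

lemma subspace_Int:
  assumes "VectorSpace.subspace class_ring U (module_vec TYPE('f::field) n)"
    and "VectorSpace.subspace class_ring W (module_vec TYPE('f) n)"
  shows "VectorSpace.subspace class_ring (U \<inter> W) (module_vec TYPE('f) n)"
  using assms by (auto simp: VectorSpace.subspace_def submodule_def)

lemma subspace_sum: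
  assumes "VectorSpace.subspace class_ring U (module_vec TYPE('f::field) n)"
    and "VectorSpace.subspace class_ring W (module_vec TYPE('f) n)"
  shows "VectorSpace.subspace class_ring (module.submodule_sum (module_vec TYPE('f) n) U W) (module_vec TYPE('f) n)"
  using vectorspace.sum_is_subspace[OF vec_vs assms] .

text \<open>The pairs in \<open>U \<times> W\<close> with a given sum \<open>z\<close> are (x0 + t,
  y0 - t) with \<open>t\<close> in the intersection, so all fibres of addition have size
  \<open>card (U \<inter> W)\<close>.\<close>

lemma subspace_dim_sum_Int:
  fixes U W :: "'f::{finite,field} vec set"
  assumes U: "VectorSpace.subspace class_ring U (module_vec TYPE('f) n)"
    and W: "VectorSpace.subspace class_ring W (module_vec TYPE('f) n)"
  shows "subspace_dim n (module.submodule_sum (module_vec TYPE('f) n) U W) + subspace_dim n (U \<inter> W)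
    = subspace_dim n U + subspace_dim n W"
proof -
  define Z where "Z = module.submodule_sum (module_vec TYPE('f) n) U W"
  have Z: "Z = (\<lambda>(x, y). x + y) ` (U \<times> W)" unfolding Z_def by (rule submodule_sum_vec)
  obtain P where P: "P \<in> carrier_mat n (subspace_dim n U)" "mat_image P = U"
    using subspace_eq_mat_image[OF U] by blast
  obtain R where R: "R \<in> carrier_mat n (subspace_dim n W)" "mat_image R = W"
    using subspace_eq_mat_image[OF W] by blast
  note Ucl = mat_image_closed[OF P(1), unfolded P(2)] and Wcl = mat_image_closed[OF R(1), unfolded R(2)]
  have Uc: "U \<subseteq> carrier_vec n" using mat_image_subset[OF P(1)] P(2) by simp
  have Wc: "W \<subseteq> carrier_vec n" using mat_image_subset[OF R(1)] R(2) by simp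
  have finU: "finite U" "finite W" using P(2) R(2) finite_mat_image by metis+
  have fibre: "card {p \<in> U \<times> W. (\<lambda>(x, y). x + y) p = z} = card (U \<inter> W)" if "z \<in> Z" for z
  proof -
    obtain x0 y0 where 0: "x0 \<in> U" "y0 \<in> W" "z = x0 + y0" using \<open>z \<in> Z\<close> by (auto simp: Z)
    have c0: "x0 \<in> carrier_vec n" "y0 \<in> carrier_vec n" using 0 Uc Wc by auto
    have "bij_betw (\<lambda>t. (x0 + t, y0 - t)) (U \<inter> W) {p \<in> U \<times> W. (\<lambda>(x, y). x + y) p = z}"
    proof (rule bij_betw_byWitness[where f' = "\<lambda>(x, y). x - x0"])
      show "\<forall>t\<in>U \<inter> W. (\<lambda>(x, y). x - x0) (x0 + t, y0 - t) = t"
      proof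
        fix t assume "t \<in> U \<inter> W"
        then have "t \<in> carrier_vec n" using Uc by auto
        then show "(\<lambda>(x, y). x - x0) (x0 + t, y0 - t) = t" using c0 by (auto intro!: eq_vecI)
      qed
      have key: "x - x0 = y0 - y \<and> x0 + (x - x0) = x \<and> y0 - (x - x0) = y"
        if xy: "x \<in> U" "y \<in> W" "x + y = z" for x y
      proof -
        have c: "x \<in> carrier_vec n" "y \<in> carrier_vec n" using xy Uc Wc by auto
        have "x $ i - x0 $ i = y0 $ i - y $ i" if "i < n" for i
          using arg_cong[OF xy(3)[unfolded 0(3)], of "\<lambda>v. v $ i"] that c c0 by (simp add: algebra_simps)
        then have "x - x0 = y0 - y" using c c0 by (intro eq_vecI) auto
        moreover have "y0 - (y0 - y) = y" using c c0 by (intro eq_vecI) auto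
        moreover have "x0 + (x - x0) = x" using c c0 by (intro eq_vecI) auto
        ultimately show ?thesis by simp
      qed
      show "\<forall>p\<in>{p \<in> U \<times> W. (\<lambda>(x, y). x + y) p = z}.
          (\<lambda>t. (x0 + t, y0 - t)) ((\<lambda>(x, y). x - x0) p) = p"
        using key by auto
      show "(\<lambda>t. (x0 + t, y0 - t)) ` (U \<inter> W) \<subseteq> {p \<in> U \<times> W. (\<lambda>(x, y). x + y) p = z}"
      proof (rule image_subsetI)
        fix t assume t: "t \<in> U \<inter> W"
        then have "t \<in> carrier_vec n" using Uc by auto
        then have "x0 + t + (y0 - t) = z" using c0 0(3) by (auto intro!: eq_vecI)
        then show "(x0 + t, y0 - t) \<in> {p \<in> U \<times> W. (\<lambda>(x, y). x + y) p = z}"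
          using Ucl(1)[OF 0(1)] Wcl(2)[OF 0(2)] t by auto
      qed
      show "(\<lambda>(x, y). x - x0) ` {p \<in> U \<times> W. (\<lambda>(x, y). x + y) p = z} \<subseteq> U \<inter> W"
      proof (rule image_subsetI)
        fix p assume "p \<in> {p \<in> U \<times> W. (\<lambda>(x, y). x + y) p = z}"
        then obtain x y where p: "p = (x, y)" "x \<in> U" "y \<in> W" "x + y = z" by auto
        then show "(\<lambda>(x, y). x - x0) p \<in> U \<inter> W"
          using key[OF p(2-4)] Ucl(2)[OF p(2) 0(1)] Wcl(2)[OF 0(2) p(3)] by auto
      qed
    qed
    then show ?thesis by (simp add: bij_betw_same_card)
  qed
  have "card (U \<times> W) = (\<Sum>p\<in>U \<times> W. 1 :: nat)" by simp
  also have "\<dots> = (\<Sum>z\<in>Z. \<Sum>p | p \<in> U \<times> W \<and> (\<lambda>(x, y). x + y) p = z. 1)"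
    unfolding Z using finU by (intro sum.image_gen) auto
  also have "\<dots> = card Z * card (U \<inter> W)" using fibre by simp
  finally have "card U * card W = card Z * card (U \<inter> W)" by (simp add: card_cartesian_product)
  then have "CARD('f) ^ (subspace_dim n U + subspace_dim n W) = CARD('f) ^ (subspace_dim n Z + subspace_dim n (U \<inter> W))"
    unfolding Z_def using card_subspace[OF U] card_subspace[OF W] card_subspace[OF subspace_Int[OF U W]]
      card_subspace[OF subspace_sum[OF U W]] by (simp add: power_add)
  then show ?thesis using CARD_field_gt_1[where 'f = 'f] by (simp add: Z_def)
qed

section \<open>Translation between matrix codes and subspace codes\<close>

lemma card_le_A_code:
  "constant_dim_code v d k (C :: 'f::{finite,field} vec set set) \<Longrightarrow> card C \<le> A_code TYPE('f) v d k"
  unfolding A_code_def using A_code_Max_wf(1)[of v d k] by (intro Max_ge) auto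

lemma A_code_attained:
  obtains C :: "'f::{finite,field} vec set set"
  where "constant_dim_code v d k C" "card C = A_code TYPE('f) v d k"
proof -
  have "A_code TYPE('f) v d k \<in> card ` {C :: 'f vec set set. constant_dim_code v d k C}"
    unfolding A_code_def using A_code_Max_wf[of v d k] by (intro Max_in) auto
  then show ?thesis using that by auto
qed

text \<open>Needed for matrix codes with at most one element: such a codeword may have rank below
  \<open>u\<close>, so its column space need not qualify.\<close>

lemma A_code_ge_1:
  assumes "k \<le> v"
  shows "1 \<le> A_code TYPE('f::{finite,field}) v d k"
proof -
  define U where "U = mat_image (pad_mat v k :: 'f mat)"
  have "subspace_dim v U = k"
    using mat_rank_eq_subspace_dim[of "pad_mat v k :: 'f mat"]
      mat_rank_of_inj[OF pad_mat_carrier inj_on_pad_mat[OF assms, where 'f = 'f]]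
    by (simp add: U_def pad_mat_def)
  moreover have "VectorSpace.subspace class_ring U (module_vec TYPE('f) v)"
    unfolding U_def by (rule subspace_mat_image[OF pad_mat_carrier])
  ultimately have "constant_dim_code v d k {U}" by (simp add: constant_dim_code_def)
  then show ?thesis using card_le_A_code by fastforce
qed

lemma Lambda_le_A_code:
  assumes "0 < u" "u \<le> m"
  shows "Lambda TYPE('f::{finite,field}) m n (2 * u) u \<le> A_code TYPE('f) m (2 * u) u"
proof -
  obtain C :: "'f mat set" where C: "rank_metric_code m n (2 * u) u C"
    "card C = Lambda TYPE('f) m n (2 * u) u"
    by (rule Lambda_attained)
  show ?thesis
  proof (cases "card C \<le> 1")
    case True
    then show ?thesis using C(2) A_code_ge_1[OF assms(2), where 'f = 'f and d = "2 * u"] by simp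
  next
    case False
    have carr: "X \<in> carrier_mat m n" and le: "mat_rank X \<le> u" if "X \<in> C" for X
      using C that by (auto simp: rank_metric_code_def)
    have dist: "2 * u \<le> mat_rank (X - Y)" if "X \<in> C" "Y \<in> C" "X \<noteq> Y" for X Y
      using C that by (auto simp: rank_metric_code_def)
    have rank: "mat_rank X = u" if X: "X \<in> C" for X
    proof -
      \<comment> \<open>With a second codeword \<open>Y\<close>, the ranks of \<open>X\<close> and
        \<open>Y\<close> sum to at least \<open>2 * u\<close> while each is at most
        \<open>u\<close>, which leaves no slack.\<close>
      have "C \<noteq> {X}" using False by auto
      then obtain Y where Y: "Y \<in> C" "X \<noteq> Y" using X by blast
      show ?thesis
        using dist[OF X Y] mat_rank_minus_le[OF carr[OF X] carr[OF Y(1)]] le[OF X] le[OF Y(1)] by linarith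
    qed
    have sub: "VectorSpace.subspace class_ring (mat_image X) (module_vec TYPE('f) m)" if "X \<in> C" for X
      using subspace_mat_image[OF carr[OF that]] .
    have dim: "subspace_dim m (mat_image X) = u" if "X \<in> C" for X
      using mat_rank_eq_subspace_dim[of X] rank[OF that] carr[OF that] by simp
    have sdist: "2 * u \<le> subspace_dist m (mat_image X) (mat_image Y)"
      if X: "X \<in> C" and Y: "Y \<in> C" and ne: "X \<noteq> Y" for X Y
    proof -
      define Z where "Z = module.submodule_sum (module_vec TYPE('f) m) (mat_image X) (mat_image Y)"
      have Zs: "VectorSpace.subspace class_ring Z (module_vec TYPE('f) m)"
        unfolding Z_def by (rule subspace_sum[OF sub[OF X] sub[OF Y]])
      have Xc: "X \<in> carrier_mat m n" and Yc: "Y \<in> carrier_mat m n" using carr X Y by auto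
      \<comment> \<open>The sum of the two images then has dimension at least \<open>2 * u\<close>,
        so the dimension formula leaves dimension 0 for the intersection.\<close>
      have "mat_image (X - Y) \<subseteq> Z"
      proof
        fix w assume "w \<in> mat_image (X - Y)"
        then obtain x where x: "x \<in> carrier_vec n" "w = (X - Y) *\<^sub>v x"
          using Yc by (auto simp: mat_image_def)
        have "w = X *\<^sub>v x + Y *\<^sub>v (- x)"
          using x Xc Yc by (auto simp: minus_mult_distrib_mat_vec intro!: eq_vecI)
        moreover have "X *\<^sub>v x \<in> mat_image X" "Y *\<^sub>v (- x) \<in> mat_image Y"
          using x Xc Yc by (auto simp: mat_image_def)
        ultimately show "w \<in> Z" unfolding Z_def submodule_sum_vec by force
      qed
      moreover have "finite Z"
        unfolding Z_def submodule_sum_vec using finite_mat_image by (intro finite_imageI finite_cartesian_product)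
      ultimately have "CARD('f) ^ mat_rank (X - Y) \<le> CARD('f) ^ subspace_dim m Z"
        unfolding card_mat_image[symmetric] card_subspace[OF Zs, symmetric] by (intro card_mono)
      then have "mat_rank (X - Y) \<le> subspace_dim m Z"
        using CARD_field_gt_1[where 'f = 'f] by simp
      then have "2 * u \<le> subspace_dim m Z" using dist[OF X Y ne] by simp
      moreover have "subspace_dim m Z + subspace_dim m (mat_image X \<inter> mat_image Y) = 2 * u"
        using subspace_dim_sum_Int[OF sub[OF X] sub[OF Y]] dim[OF X] dim[OF Y] by (simp add: Z_def)
      ultimately show ?thesis by (simp add: subspace_dist_def flip: Z_def)
    qed
    have inj: "inj_on mat_image C"
    proof (rule inj_onI, rule ccontr)
      fix X Y assume X: "X \<in> C" and Y: "Y \<in> C" and eq: "mat_image X = mat_image Y" and ne: "X \<noteq> Y"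
      have "subspace_dim m (module.submodule_sum (module_vec TYPE('f) m) (mat_image X) (mat_image Y)) + u = 2 * u"
        using subspace_dim_sum_Int[OF sub[OF X] sub[OF Y]] dim[OF X] dim[OF Y] eq by simp
      then show False using sdist[OF X Y ne] assms(1) by (simp add: subspace_dist_def)
    qed
    have "constant_dim_code m (2 * u) u (mat_image ` C)"
      unfolding constant_dim_code_def using sub dim sdist by blast
    then have "card (mat_image ` C) \<le> A_code TYPE('f) m (2 * u) u" by (rule card_le_A_code)
    then show ?thesis using C(2) card_image[OF inj] by simp
  qed
qed

text \<open>The assumption \<open>m \<le> n\<close> makes \<open>E\<close> injective, so
  \<open>E * B U\<close> still has independent columns and trivial intersections of members of
  \<open>C\<close> stay trivial after applying \<open>E\<close>.\<close>

lemma A_code_le_Lambda: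
  assumes "0 < u" "m \<le> n"
  shows "A_code TYPE('f::{finite,field}) m (2 * u) u \<le> Lambda TYPE('f) m n (2 * u) u"
proof -
  obtain C :: "'f vec set set" where C: "constant_dim_code m (2 * u) u C"
    "card C = A_code TYPE('f) m (2 * u) u"
    by (rule A_code_attained)
  have sub: "VectorSpace.subspace class_ring U (module_vec TYPE('f) m)" and dim: "subspace_dim m U = u"
    if "U \<in> C" for U
    using C that by (auto simp: constant_dim_code_def)
  have "\<exists>P. P \<in> carrier_mat m u \<and> inj_on ((*\<^sub>v) P) (carrier_vec u) \<and> mat_image P = U" if "U \<in> C" for U
    using subspace_eq_mat_image[OF sub[OF that]] unfolding dim[OF that] by metis
  then obtain B where B: "\<And>U. U \<in> C \<Longrightarrow> B U \<in> carrier_mat m u"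
    and injB: "\<And>U. U \<in> C \<Longrightarrow> inj_on ((*\<^sub>v) (B U)) (carrier_vec u)"
    and imB: "\<And>U. U \<in> C \<Longrightarrow> mat_image (B U) = U"
    by metis
  define E where "E = (pad_mat n m :: 'f mat)"
  have E: "E \<in> carrier_mat n m" by (simp add: E_def)
  have injE: "inj_on ((*\<^sub>v) E) (carrier_vec m)" unfolding E_def by (rule inj_on_pad_mat[OF assms(2)])
  have EB: "E * B U \<in> carrier_mat n u" if "U \<in> C" for U using E B[OF that] by simp
  have injEB: "inj_on ((*\<^sub>v) (E * B U)) (carrier_vec u)" if "U \<in> C" for U
  proof (rule inj_on_mult_mat_vecI[OF EB[OF that]])
    fix x assume x: "x \<in> carrier_vec u" and "E * B U *\<^sub>v x = 0\<^sub>v n"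
    then have "E *\<^sub>v (B U *\<^sub>v x) = 0\<^sub>v n" using assoc_mult_mat_vec[OF E B[OF that] x] by simp
    then have "B U *\<^sub>v x = 0\<^sub>v m" using B[OF that] x by (intro inj_on_mult_mat_vecD[OF injE E]) auto
    then show "x = 0\<^sub>v u" by (rule inj_on_mult_mat_vecD[OF injB[OF that] B[OF that] x])
  qed
  have imEB: "mat_image (E * B U) = (*\<^sub>v) E ` U" if "U \<in> C" for U
  proof -
    have "mat_image (E * B U) = (*\<^sub>v) E ` mat_image (B U)"
      using E B[OF that] by (auto simp: mat_image_def image_image)
    then show ?thesis by (simp only: imB[OF that])
  qed
  define X where "X U = B U * (E * B U)\<^sup>T" for U
  have X: "X U \<in> carrier_mat m n" if "U \<in> C" for U
    using B[OF that] EB[OF that] by (simp add: X_def)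
  have rankX: "mat_rank (X U) \<le> u" if "U \<in> C" for U
    using mat_rank_mult_le[OF B[OF that], of "(E * B U)\<^sup>T" n] mat_rank_le_dim_col[OF B[OF that]] EB[OF that]
    unfolding X_def by simp
  have distX: "mat_rank (X U - X W) = 2 * u" if U: "U \<in> C" and W: "W \<in> C" and ne: "U \<noteq> W" for U W
  proof -
    have "2 * u \<le> subspace_dist m U W" using C U W ne by (auto simp: constant_dim_code_def)
    \<comment> \<open>The dimensions of sum and intersection add up to \<open>2 * u\<close> and
      differ by at least \<open>2 * u\<close>.\<close>
    then have "subspace_dim m (U \<inter> W) = 0"
      using subspace_dim_sum_Int[OF sub[OF U] sub[OF W]] dim[OF U] dim[OF W] by (simp add: subspace_dist_def)
    then have "card (U \<inter> W) = 1" using card_subspace[OF subspace_Int[OF sub[OF U] sub[OF W]]] by simp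
    then obtain w where w: "U \<inter> W = {w}" by (auto simp: card_1_singleton_iff)
    have Uc: "U \<subseteq> carrier_vec m" and Wc: "W \<subseteq> carrier_vec m"
      using mat_image_subset[OF B[OF U]] mat_image_subset[OF B[OF W]] imB[OF U] imB[OF W] by auto
    have zero: "0\<^sub>v m \<in> V" if "V \<in> C" for V
    proof -
      have "B V *\<^sub>v 0\<^sub>v u = 0\<^sub>v m" using B[OF that] by (intro eq_vecI) auto
      moreover have "B V *\<^sub>v 0\<^sub>v u \<in> mat_image (B V)" using B[OF that] by (auto simp: mat_image_def)
      ultimately show ?thesis using imB[OF that] by simp
    qed
    then have "0\<^sub>v m \<in> U \<inter> W" using U W by blast
    then have UW: "U \<inter> W = {0\<^sub>v m}" using w by simp
    have "E *\<^sub>v 0\<^sub>v m = 0\<^sub>v n" using E by (intro eq_vecI) auto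
    then have EUW: "(*\<^sub>v) E ` U \<inter> (*\<^sub>v) E ` W = {0\<^sub>v n}"
      using inj_on_image_Int[OF injE Uc Wc] UW by simp
    show ?thesis
      unfolding X_def mult_2
      by (rule mat_rank_diff_of_disjoint[OF B[OF U] B[OF W] EB[OF U] EB[OF W] injB[OF U] injB[OF W]
            injEB[OF U] injEB[OF W]]) (use imB[OF U] imB[OF W] imEB[OF U] imEB[OF W] UW EUW in simp_all)
  qed
  have "inj_on X C"
  proof (rule inj_onI, rule ccontr)
    fix U W assume U: "U \<in> C" and W: "W \<in> C" and eq: "X U = X W" and ne: "U \<noteq> W"
    have "X U - X W = 0\<^sub>m m n" unfolding eq using X[OF W] by (intro eq_matI) auto
    then show False using distX[OF U W ne] assms(1) by (simp add: mat_rank_zero)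
  qed
  moreover have "rank_metric_code m n (2 * u) u (X ` C)"
    unfolding rank_metric_code_def
  proof (intro conjI ballI impI)
    show "X ` C \<subseteq> carrier_mat m n" using X by blast
    fix Y assume "Y \<in> X ` C"
    then show "mat_rank Y \<le> u" using rankX by blast
  next
    fix Y Y' assume "Y \<in> X ` C" "Y' \<in> X ` C" "Y \<noteq> Y'"
    then obtain U W where "U \<in> C" "W \<in> C" "U \<noteq> W" "Y = X U" "Y' = X W" by blast
    then show "2 * u \<le> mat_rank (Y - Y')" using distX[of U W] by simp
  qed
  ultimately show ?thesis using C(2) card_le_Lambda by (metis card_image)
qed

text \<open>The bound \<open>u \<le> min a b\<close> is essential: for larger \<open>u\<close> the
  left side is 1 by \<open>Lambda_eq_1\<close>, while no subspace of dimension \<open>u\<close>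
  exists and the right side is 0.\<close>

lemma Lambda_eq_A_code:
  assumes "0 < u" "u \<le> min a b"
  shows "Lambda TYPE('f::{finite,field}) a b (2 * u) u = A_code TYPE('f) (min a b) (2 * u) u"
proof -
  have "Lambda TYPE('f) a b (2 * u) u = Lambda TYPE('f) (min a b) (max a b) (2 * u) u"
    using Lambda_commute[where 'f = 'f] by (cases "a \<le> b") (simp_all add: max_def min_def)
  also have "\<dots> = A_code TYPE('f) (min a b) (2 * u) u"
    using assms by (intro antisym Lambda_le_A_code A_code_le_Lambda) auto
  finally show ?thesis .
qed

theorem theorem12:
  fixes q a b d u :: nat
  assumes "primepow q"
    and "CARD('f::{finite,field}) = q"
    and "a > 0" and "b > 0" and "d > 0" and "u > 0"
  shows "(2 * u < d \<or> min a b < d \<longrightarrow> Lambda TYPE('f) a b d u = 1)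
    \<and> (min a b \<le> u \<longrightarrow> int (Lambda TYPE('f) a b d u) = M_bound q a b d)
    \<and> real (Lambda TYPE('f) a b 1 u) =
        (\<Sum>r=0..min u (min a b). real q ^ (r choose 2) * (real q - 1) ^ r * q_fact q r
           * q_binomial q a r * q_binomial q b r)
    \<and> (u \<le> min a b \<longrightarrow> Lambda TYPE('f) a b (2 * u) u = A_code TYPE('f) (min a b) (2 * u) u)"
proof (intro conjI impI)
  have q: "q = CARD('f)" and pp: "primepow CARD('f)" using assms(1,2) by simp_all
  show "Lambda TYPE('f) a b d u = 1" if "2 * u < d \<or> min a b < d"
    using that by (rule Lambda_eq_1)
  show "int (Lambda TYPE('f) a b d u) = M_bound q a b d" if "min a b \<le> u"
    unfolding q by (rule Lambda_eq_M_bound[OF pp assms(5) that])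
  show "real (Lambda TYPE('f) a b 1 u) =
      (\<Sum>r=0..min u (min a b). real q ^ (r choose 2) * (real q - 1) ^ r * q_fact q r
         * q_binomial q a r * q_binomial q b r)"
    unfolding q by (rule Lambda_distance_1)
  show "Lambda TYPE('f) a b (2 * u) u = A_code TYPE('f) (min a b) (2 * u) u" if "u \<le> min a b"
    by (rule Lambda_eq_A_code[OF assms(6) that])
qed

end
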